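(* Let $\Bbbk$ be an algebraically closed field of characteristic zero, let $h\in\Bbbk[x]\setminus\Bbbk$ be square-free, and let $A_h=\Bbbk[x][t;h(x)\partial_x]$. Then $\mathrm{LFD}(A_h)$ is a solvable Lie subalgebra of $\mathrm{Der}(A_h)$. Moreover, $\mathrm{LFD}(A_h)$ is weakly locally finite, but it is not locally finite as a set of derivations.
   Context: $A_h=\Bbbk[x][t;h(x)\partial_x]$ is the associative unital $\Bbbk$-algebra generated by $x,t$ subject to the relation $tx-xt=h(x)$. Square-free means $\gcd(h,h')=1$. $\mathrm{Der}(A_h)$ is the Lie algebra of $\Bbbk$-linear derivations of $A_h$ under the commutator bracket. A derivation $D$ of a $\Bbbk$-algebra $B$ is locally finite if for every $b\in B$ the space $\mathrm{Span}_\Bbbk\{D^n(b)\mid n\ge0\}$ is finite-dimensional; $\mathrm{LFD}(B)$ denotes the set of all locally finite derivations of $B$. A subset $\Delta\subseteq\mathrm{Der}(B)$ is locally finite (as a set of derivations) if for every $b\in B$ there exists a finite-dimensional $\Bbbk$-subspace $U_b\subseteq B$ with $b\in U_b$ and $D(U_b)\subseteq U_b$ for every $D\in\Delta$. A subset $\Delta\subseteq\mathrm{Der}(B)$ is weakly locally finite if every finite subset of $\Delta$ is locally finite as a set of derivations. *)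

theory Defs
  imports
    "HOL-Algebra.Algebraic_Closure_Type"
    "HOL-Library.Poly_Mapping"
    "HOL-Library.FuncSet"
begin

section \<open>Free algebras\<close>

text \<open>
  The free monoid is written additively, so that finitely supported functions on it carry the
  convolution product of \<^theory>\<open>HOL-Library.Poly_Mapping\<close>. Hence
  \<open>'g free_monoid \<Rightarrow>\<^sub>0 'k\<close> is the free associative unital \<open>'k\<close>-algebra on the
  generators \<open>'g\<close>.
\<close>

datatype 'g free_monoid = Word "'g list"

instantiation free_monoid :: (type) monoid_add
begin

definition zero_free_monoid :: "'a free_monoid" where
  "zero_free_monoid = Word []"

fun plus_free_monoid :: "'a free_monoid \<Rightarrow> 'a free_monoid \<Rightarrow> 'a free_monoid" where
  "plus_free_monoid (Word u) (Word v) = Word (u @ v)"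

instance
proof
  fix a b c :: "'a free_monoid"
  show "a + b + c = a + (b + c)" by (cases a; cases b; cases c) simp
  show "0 + a = a" by (cases a) (simp add: zero_free_monoid_def)
  show "a + 0 = a" by (cases a) (simp add: zero_free_monoid_def)
qed

end

definition free_const :: "'k \<Rightarrow> 'g free_monoid \<Rightarrow>\<^sub>0 'k::field" where
  "free_const c = Poly_Mapping.single 0 c"

definition free_gen :: "'g \<Rightarrow> 'g free_monoid \<Rightarrow>\<^sub>0 'k::field" where
  "free_gen g = Poly_Mapping.single (Word [g]) 1"

text \<open>
  Associative unital algebras over the field given by the type \<open>'k\<close> are represented by records of
  type \<open>('k, 'a) module\<close>, which have a multiplication and a unit besides the module operations.
\<close>

definition free_algebra :: "('k::field, 'g free_monoid \<Rightarrow>\<^sub>0 'k) module" where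
  "free_algebra = ring.extend ring_of_type_algebra (module.fields (\<lambda>c p. free_const c * p))"

definition quotient_algebra ::
    "('k, 'a, 'm) module_scheme \<Rightarrow> 'a set \<Rightarrow> ('k, 'a set) module" where
  "quotient_algebra A I =
     ring.extend (A Quot I) (module.fields (\<lambda>c C. \<Union>a\<in>C. I +>\<^bsub>A\<^esub> (c \<odot>\<^bsub>A\<^esub> a)))"


section \<open>The algebra $A_h$\<close>

datatype gen = Gen_x | Gen_t

definition free_poly :: "'k::field poly \<Rightarrow> gen free_monoid \<Rightarrow>\<^sub>0 'k" where
  "free_poly h = (\<Sum>i\<le>degree h. free_const (coeff h i) * free_gen Gen_x ^ i)"

definition A_relator :: "'k::field poly \<Rightarrow> gen free_monoid \<Rightarrow>\<^sub>0 'k" where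
  "A_relator h = free_gen Gen_t * free_gen Gen_x - free_gen Gen_x * free_gen Gen_t - free_poly h"

definition A_alg :: "'k::field poly \<Rightarrow> ('k, (gen free_monoid \<Rightarrow>\<^sub>0 'k) set) module" where
  "A_alg h = quotient_algebra free_algebra (genideal free_algebra {A_relator h})"


section \<open>Linear algebra\<close>

abbreviation subspace_of :: "'a set \<Rightarrow> ('k::field, 'a) module \<Rightarrow> bool" where
  "subspace_of U M \<equiv> submodule U (ring_of_type_algebra :: 'k ring) M"

definition span_of :: "('k::field, 'a) module \<Rightarrow> 'a set \<Rightarrow> 'a set" where
  "span_of M S = \<Inter>{U. subspace_of U M \<and> S \<subseteq> U}"

definition fin_dim_subspace :: "('k::field, 'a) module \<Rightarrow> 'a set \<Rightarrow> bool" where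
  "fin_dim_subspace M U \<longleftrightarrow> subspace_of U M \<and> (\<exists>B. finite B \<and> B \<subseteq> U \<and> U = span_of M B)"

text \<open>
  The carrier consists of extensional functions, so that two linear maps are equal as soon as they
  agree on the carrier of \<open>A\<close>.
\<close>

definition End_alg :: "('k::field, 'a) module \<Rightarrow> ('k, 'a \<Rightarrow> 'a) module" where
  "End_alg A = \<lparr>
     carrier = {D \<in> carrier A \<rightarrow>\<^sub>E carrier A.
       (\<forall>a\<in>carrier A. \<forall>b\<in>carrier A. D (a \<oplus>\<^bsub>A\<^esub> b) = D a \<oplus>\<^bsub>A\<^esub> D b) \<and>
       (\<forall>c. \<forall>a\<in>carrier A. D (c \<odot>\<^bsub>A\<^esub> a) = c \<odot>\<^bsub>A\<^esub> D a)},
     monoid.mult = compose (carrier A),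
     one = (\<lambda>a\<in>carrier A. a),
     ring.zero = (\<lambda>a\<in>carrier A. \<zero>\<^bsub>A\<^esub>),
     add = (\<lambda>D E. \<lambda>a\<in>carrier A. D a \<oplus>\<^bsub>A\<^esub> E a),
     module.smult = (\<lambda>c D. \<lambda>a\<in>carrier A. c \<odot>\<^bsub>A\<^esub> D a)\<rparr>"


section \<open>Lie algebras of linear maps\<close>

text \<open>
  Below, \<open>E\<close> is an associative algebra, regarded as a Lie algebra under the commutator bracket.
\<close>

definition commutator :: "('k, 'a) module \<Rightarrow> 'a \<Rightarrow> 'a \<Rightarrow> 'a" where
  "commutator E a b = (a \<otimes>\<^bsub>E\<^esub> b) \<ominus>\<^bsub>E\<^esub> (b \<otimes>\<^bsub>E\<^esub> a)"

definition lie_subalgebra :: "('k::field, 'a) module \<Rightarrow> 'a set \<Rightarrow> 'a set \<Rightarrow> bool" where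
  "lie_subalgebra E M L \<longleftrightarrow>
     L \<subseteq> M \<and> subspace_of L E \<and> (\<forall>a\<in>L. \<forall>b\<in>L. commutator E a b \<in> L)"

fun derived_series :: "('k::field, 'a) module \<Rightarrow> 'a set \<Rightarrow> nat \<Rightarrow> 'a set" where
  "derived_series E L 0 = L"
| "derived_series E L (Suc n) =
     span_of E {commutator E a b | a b. a \<in> derived_series E L n \<and> b \<in> derived_series E L n}"

definition lie_solvable :: "('k::field, 'a) module \<Rightarrow> 'a set \<Rightarrow> bool" where
  "lie_solvable E L \<longleftrightarrow> (\<exists>n. derived_series E L n = {\<zero>\<^bsub>E\<^esub>})"


section \<open>Derivations and local finiteness\<close>

definition Der :: "('k::field, 'a) module \<Rightarrow> ('a \<Rightarrow> 'a) set" where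
  "Der A = {D \<in> carrier (End_alg A). \<forall>a\<in>carrier A. \<forall>b\<in>carrier A.
     D (a \<otimes>\<^bsub>A\<^esub> b) = (D a \<otimes>\<^bsub>A\<^esub> b) \<oplus>\<^bsub>A\<^esub> (a \<otimes>\<^bsub>A\<^esub> D b)}"

definition locally_finite_der :: "('k::field, 'a) module \<Rightarrow> ('a \<Rightarrow> 'a) \<Rightarrow> bool" where
  "locally_finite_der A D \<longleftrightarrow>
     (\<forall>b\<in>carrier A. fin_dim_subspace A (span_of A (range (\<lambda>n. (D ^^ n) b))))"

definition LFD :: "('k::field, 'a) module \<Rightarrow> ('a \<Rightarrow> 'a) set" where
  "LFD A = {D \<in> Der A. locally_finite_der A D}"

definition locally_finite_set :: "('k::field, 'a) module \<Rightarrow> ('a \<Rightarrow> 'a) set \<Rightarrow> bool" where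
  "locally_finite_set A \<Delta> \<longleftrightarrow>
     (\<forall>b\<in>carrier A. \<exists>U. fin_dim_subspace A U \<and> b \<in> U \<and> (\<forall>D\<in>\<Delta>. D ` U \<subseteq> U))"

definition weakly_locally_finite_set :: "('k::field, 'a) module \<Rightarrow> ('a \<Rightarrow> 'a) set \<Rightarrow> bool" where
  "weakly_locally_finite_set A \<Delta> \<longleftrightarrow>
     (\<forall>F. finite F \<longrightarrow> F \<subseteq> \<Delta> \<longrightarrow> locally_finite_set A F)"

end

theory Submission
  imports Defs
begin

text \<open>
  Every element of $A_h$ is uniquely of the form $\sum_i f_i(x) t^i$, so $A_h$ is the space
  $k[x][t]$ with a twisted product. Its locally finite derivations can then be listed
  completely, and the claims are read off from the list.

  Commutators lie in the ideal $hA_h$, because $A_h/hA_h$ is commutative. As $h = [t,x]$, a derivation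
  $D$ maps $h$ into this ideal; modulo the ideal this says $h'(x) D(x) = 0$, and since $h$ is
  square-free, $h$ divides $D(x)$. In characteristic zero every multiple of $h$ is a commutator
  $[b,x]$, so $D = \mathrm{ad}_b + E$ where $E$ kills $x$. Then $E(t)$ commutes with $x$, hence is a
  polynomial in $x$ (\<open>derivation_decomposition\<close>).

  Suppose $b$ has degree $n \geq 1$ in $t$ and leading coefficient $g(x)$. The leading term of
  $[b, f t^m]$ is $h (n g f' - m f g') t^{n+m-1}$. Starting from $x$ and iterating, the degrees in $x$
  never let the bracket vanish: $D^k(x)$ has degree $k(n-1)$ in $t$ and its leading coefficient has
  degree $1 + k(\deg g + \deg h - 1)$. Both stay bounded only if $n = 1$, $g$ is constant and
  $\deg h = 1$. Thus a locally finite derivation is \<^emph>\<open>triangular\<close>: it maps $x$ to $c h$, with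
  $c = 0$ unless $\deg h = 1$, and $t$ to a polynomial in $x$ (\<open>locally_finite_imp_triangular\<close>).

  Conversely, give $x$ weight $1$ and $t$ a large weight $N$. Finitely many triangular derivations do
  not raise the weight once $N$ is large enough, and the elements of bounded weight form a
  finite-dimensional space (\<open>finite_triangular_invariant_space\<close>). This shows that the locally finite
  derivations are exactly the triangular ones and that the set of them is weakly locally finite. The
  bracket of two triangular derivations kills $x$ and maps $t$ into $k[x]$, and any two derivations
  with these properties commute, so the Lie algebra is solvable. Finally all $\mathrm{ad}_f$ with
  $f \in k[x]$ are triangular, and they map $t$ to the polynomials $-h f'$ of unbounded degree; so no
  finite-dimensional space containing $t$ is stable under all of them.
\<close>

section \<open>The twisted product on $k[x][t]$\<close>

text \<open>
  The polynomial $\sum_i f_i t^i$ stands for the normal form of an element of $A_h$, with the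
  coefficients $f_i \in k[x]$ on the left. From $t f = f t + h f'$, left multiplication by $t$ is the
  following operator, and a normal form multiplies by substituting this operator for $t$.
\<close>

definition t_act :: "'k::field poly \<Rightarrow> 'k poly poly \<Rightarrow> 'k poly poly" where
  "t_act h q = pCons 0 q + map_poly (\<lambda>f. h * pderiv f) q"

definition omult :: "'k::field poly \<Rightarrow> 'k poly poly \<Rightarrow> 'k poly poly \<Rightarrow> 'k poly poly" where
  "omult h p q = (\<Sum>i\<le>degree p. smult (coeff p i) ((t_act h ^^ i) q))"

abbreviation x_elt :: "'k::field poly poly" where "x_elt \<equiv> [:[:0, 1:]:]"
abbreviation t_elt :: "'k::field poly poly" where "t_elt \<equiv> [:0, 1:]"

lemma coeff_t_act:
  "coeff (t_act h q) k = (case k of 0 \<Rightarrow> 0 | Suc j \<Rightarrow> coeff q j) + h * pderiv (coeff q k)"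
  by (simp add: t_act_def coeff_map_poly coeff_pCons)

lemma t_act_add: "t_act h (p + q) = t_act h p + t_act h q"
  by (intro poly_eqI) (simp add: coeff_t_act pderiv_add algebra_simps split: nat.split)

lemma t_act_0 [simp]: "t_act h 0 = 0"
  by (simp add: t_act_def)

lemma t_act_smult: "t_act h (smult f q) = smult f (t_act h q) + smult (h * pderiv f) q"
  by (intro poly_eqI) (simp add: coeff_t_act pderiv_mult algebra_simps split: nat.split)

lemma t_act_pCons: "t_act h (pCons f p) = pCons (h * pderiv f) ([:f:] + t_act h p)"
  by (intro poly_eqI) (simp add: coeff_t_act coeff_pCons split: nat.split)

lemma t_act_power_add: "(t_act h ^^ i) (p + q) = (t_act h ^^ i) p + (t_act h ^^ i) q"
  by (induction i) (simp_all add: t_act_add)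

lemma omult_eq_sum:
  assumes "degree p \<le> n"
  shows "omult h p q = (\<Sum>i\<le>n. smult (coeff p i) ((t_act h ^^ i) q))"
  unfolding omult_def using assms
  by (intro sum.mono_neutral_left) (auto simp: coeff_eq_0)

lemma smult_sum_right: "smult c (\<Sum>i\<in>A. f i) = (\<Sum>i\<in>A. smult c (f i))"
  by (induction A rule: infinite_finite_induct) (simp_all add: smult_add_right)

lemma omult_0_left [simp]: "omult h 0 q = 0"
  by (simp add: omult_def)

lemma omult_add_left: "omult h (p + p') q = omult h p q + omult h p' q"
proof -
  define n where "n = max (degree p) (degree p')"
  have "degree p \<le> n" "degree p' \<le> n" "degree (p + p') \<le> n"
    by (auto simp: n_def intro: degree_add_le)
  then show ?thesis
    by (simp add: omult_eq_sum[of _ n] smult_add_left sum.distrib)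
qed

lemma omult_add_right: "omult h p (q + q') = omult h p q + omult h p q'"
  by (simp add: omult_def t_act_power_add smult_add_right sum.distrib)

lemma omult_smult_left: "omult h (smult f p) q = smult f (omult h p q)"
proof -
  have "degree (smult f p) \<le> degree p"
    by (rule degree_smult_le)
  then show ?thesis
    by (simp add: omult_eq_sum[of _ "degree p"] sum_distrib_left smult_sum_right)
qed

lemma omult_pCons: "omult h (pCons f p) q = smult f q + omult h p (t_act h q)"
proof -
  have "omult h (pCons f p) q = (\<Sum>i\<le>Suc (degree p). smult (coeff (pCons f p) i) ((t_act h ^^ i) q))"
    by (intro omult_eq_sum degree_pCons_le)
  then show ?thesis
    by (simp only: sum.atMost_Suc_shift omult_eq_sum[of p "degree p" h "t_act h q", OF order_refl])
       (simp add: funpow_swap1)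
qed

text \<open>
  Associativity rests on this case, in which the left factor is $t$; it holds because the operator
  \<open>t_act\<close> satisfies the relation $t f = f t + h f'$.
\<close>

lemma t_act_omult: "t_act h (omult h p q) = omult h (t_act h p) q"
proof (induction p arbitrary: q)
  case (pCons f p)
  then show ?case
    by (simp add: omult_pCons t_act_pCons t_act_add t_act_smult omult_add_left algebra_simps)
qed simp

lemma omult_assoc: "omult h (omult h p q) r = omult h p (omult h q r)"
proof (induction p arbitrary: q)
  case (pCons f p)
  then show ?case
    by (simp add: omult_pCons omult_add_left omult_smult_left t_act_omult)
qed simp

lemma omult_const_left: "omult h [:f:] q = smult f q"
  by (simp add: omult_pCons)

lemma omult_t_left: "omult h t_elt q = t_act h q"
  using omult_const_left[of h 1 "t_act h q"] by (simp add: omult_pCons flip: one_pCons)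

lemma t_act_monom: "t_act h (monom 1 n) = monom 1 (Suc n)"
  by (intro poly_eqI) (auto simp: coeff_t_act coeff_monom when_def pderiv_1 split: nat.split)

lemma omult_monom_right: "omult h p (monom 1 n) = p * monom 1 n"
proof (induction p arbitrary: n)
  case (pCons f p)
  then show ?case
    by (simp add: omult_pCons t_act_monom) (simp add: monom_Suc mult_pCons_left)
qed simp

lemma omult_one_right [simp]: "omult h p 1 = p"
  using omult_monom_right[of h p 0] by simp

lemma omult_one_left [simp]: "omult h 1 p = p"
  using omult_const_left[of h 1 p] by (simp flip: one_pCons)

lemma omult_t_right: "omult h p t_elt = pCons 0 p"
  using omult_monom_right[of h p 1] by (simp add: monom_Suc monom_0 flip: one_pCons)

lemma omult_0_right [simp]: "omult h p 0 = 0"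
  by (metis add_cancel_right_right omult_add_right)

lemma omult_diff_left: "omult h (p - p') q = omult h p q - omult h p' q"
  using omult_add_left[of h "p - p'" p'] by (simp add: algebra_simps)

lemma omult_diff_right: "omult h p (q - q') = omult h p q - omult h p q'"
  using omult_add_right[of h p "q - q'" q'] by (simp add: algebra_simps)

lemma t_act_scalar: "t_act h (smult [:c:] q) = smult [:c:] (t_act h q)"
  by (simp add: t_act_smult pderiv_pCons)

lemma omult_scalar_right: "omult h p (smult [:c:] q) = smult [:c:] (omult h p q)"
proof (induction p arbitrary: q)
  case (pCons f p)
  then show ?case
    by (simp add: omult_pCons t_act_scalar smult_add_right mult.commute)
qed simp

lemma t_act_top_coeffs:
  assumes "degree q \<le> m"
  shows "degree (t_act h q) \<le> Suc m"
    and "coeff (t_act h q) (Suc m) = coeff q m"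
    and "coeff (t_act h q) m = (case m of 0 \<Rightarrow> 0 | Suc m' \<Rightarrow> coeff q m') + h * pderiv (coeff q m)"
proof -
  have "coeff q i = 0" if "i > m" for i
    using assms that by (intro coeff_eq_0) simp
  then show "degree (t_act h q) \<le> Suc m" "coeff (t_act h q) (Suc m) = coeff q m"
    by (auto intro!: degree_le simp: coeff_t_act split: nat.split)
  show "coeff (t_act h q) m = (case m of 0 \<Rightarrow> 0 | Suc m' \<Rightarrow> coeff q m') + h * pderiv (coeff q m)"
    by (rule coeff_t_act)
qed

text \<open>
  Only the two highest coefficients of a product are needed: the top one is that of the commutative
  product, and the noncommutativity first shows in the next one, as the term with \<open>pderiv\<close>. The
  index \<open>k\<close> with \<open>Suc k = n + m\<close> replaces $n + m - 1$.
\<close>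

lemma omult_top_coeffs:
  assumes "degree p \<le> n" "degree q \<le> m"
  shows "degree (omult h p q) \<le> n + m"
    and "coeff (omult h p q) (n + m) = coeff p n * coeff q m"
    and "Suc k = n + m \<Longrightarrow> coeff (omult h p q) k =
      coeff p n * ((case m of 0 \<Rightarrow> 0 | Suc m' \<Rightarrow> coeff q m') + of_nat n * (h * pderiv (coeff q m)))
      + (case n of 0 \<Rightarrow> 0 | Suc n' \<Rightarrow> coeff p n') * coeff q m"
  using assms
proof (induction p arbitrary: q n m k)
  case 0
  {
    case 1 then show ?case by simp
  next
    case 2 then show ?case by simp
  next
    case 3 then show ?case by (simp split: nat.split)
  }
next
  case (pCons f p)
  note T = t_act_top_coeffs
  have D: "degree p \<le> n'" if "degree (pCons f p) \<le> Suc n'" for n'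
    using that by (simp add: degree_pCons_eq_if split: if_splits)
  have Z: "\<not> degree (pCons f p) \<le> 0 \<or> pCons f p = [:f:]"
    by (simp add: degree_pCons_eq_if)
  {
    case 1
    show ?case
    proof (cases n)
      case 0
      then have p: "pCons f p = [:f:]" using 1 Z by simp
      show ?thesis using 1 0 unfolding p by (auto simp: omult_const_left intro: order_trans[OF degree_smult_le])
    next
      case (Suc n')
      have "degree (omult h p (t_act h q)) \<le> n' + Suc m"
        using 1 Suc pCons.IH(1)[of n' "t_act h q" "Suc m"] D T(1)[of q m h] by simp
      moreover have "degree (smult f q) \<le> n + m"
        using 1 by (intro order_trans[OF degree_smult_le]) auto
      ultimately show ?thesis using Suc by (auto simp: omult_pCons intro: degree_add_le)
    qed
  next
    case 2
    show ?case
    proof (cases n)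
      case 0
      then have p: "pCons f p = [:f:]" using 2 Z by simp
      show ?thesis using 2 0 unfolding p by (auto simp: omult_const_left)
    next
      case (Suc n')
      have "coeff (omult h p (t_act h q)) (n' + Suc m) = coeff p n' * coeff q m"
        using 2 Suc T(2)[of q m h] pCons.IH(2)[of n' "t_act h q" "Suc m"] D T(1)[of q m h] by simp
      moreover have "coeff (smult f q) (n + m) = 0"
        using 2 Suc by (simp add: coeff_eq_0)
      ultimately show ?thesis using Suc by (simp add: omult_pCons)
    qed
  next
    case 3
    show ?case
    proof (cases n)
      case 0
      then have p: "pCons f p = [:f:]" using 3 Z by simp
      show ?thesis using 3 0 unfolding p by (auto simp: omult_const_left split: nat.split)
    next
      case (Suc n')
      then have k: "k = n' + m" using 3 by simp
      have "coeff (omult h p (t_act h q)) k = 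
        coeff p n' * ((case m of 0 \<Rightarrow> 0 | Suc m' \<Rightarrow> coeff q m') + h * pderiv (coeff q m)
           + of_nat n' * (h * pderiv (coeff q m)))
      + (case n' of 0 \<Rightarrow> 0 | Suc n' \<Rightarrow> coeff p n') * coeff q m"
        using 3 Suc k T(2,3)[of q m h] pCons.IH(3)[where n=n' and m="Suc m" and q="t_act h q" and k=k] D T(1)[of q m h] by simp
      moreover have "coeff (smult f q) k = (if n' = 0 then f * coeff q m else 0)"
        using 3 Suc k by (simp add: coeff_eq_0)
      ultimately show ?thesis using Suc
        by (simp add: omult_pCons algebra_simps coeff_pCons split: nat.split)
    qed
  }
qed

definition comm :: "'k::field poly \<Rightarrow> 'k poly poly \<Rightarrow> 'k poly poly \<Rightarrow> 'k poly poly" where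
  "comm h p q = omult h p q - omult h q p"

text \<open>
  The commutative parts cancel, and what remains on top is a Poisson bracket of the leading terms.
\<close>

lemma comm_top_coeff:
  assumes "degree p \<le> n" "degree q \<le> m" "n + m = Suc k"
  shows "degree (comm h p q) \<le> k"
    and "coeff (comm h p q) k =
      h * (of_nat n * coeff p n * pderiv (coeff q m) - of_nat m * coeff q m * pderiv (coeff p n))"
proof -
  have "coeff (comm h p q) i = 0" if "i > k" for i
  proof (cases "i = Suc k")
    case True
    then show ?thesis
      using omult_top_coeffs(2)[OF assms(1,2), of h] omult_top_coeffs(2)[OF assms(2,1), of h] assms(3)
      by (simp add: comm_def mult.commute add.commute)
  next
    case False
    then have "coeff (omult h p q) i = 0" "coeff (omult h q p) i = 0"
      using that omult_top_coeffs(1)[OF assms(1,2), of h] omult_top_coeffs(1)[OF assms(2,1), of h] assms(3)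
      by (auto intro!: coeff_eq_0)
    then show ?thesis by (simp add: comm_def)
  qed
  then show "degree (comm h p q) \<le> k" by (intro degree_le) auto
  show "coeff (comm h p q) k =
      h * (of_nat n * coeff p n * pderiv (coeff q m) - of_nat m * coeff q m * pderiv (coeff p n))"
    using omult_top_coeffs(3)[OF assms(1,2), of k h] omult_top_coeffs(3)[OF assms(2,1), of k h] assms(3)
    by (simp add: comm_def algebra_simps split: nat.split)
qed

section \<open>Derivations of the twisted product\<close>

text \<open>
  Modulo $h$ the operator \<open>t_act\<close> is multiplication by $t$. Hence the quotient by the ideal generated
  by $h$ is commutative.
\<close>

lemma const_dvd_t_act_power_diff: "[:h:] dvd (t_act h ^^ i) q - t_elt ^ i * q"
proof (induction i)
  case (Suc i)
  define r where "r = (t_act h ^^ i) q"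
  have t: "[:h:] dvd t_act h p - t_elt * p" for p
    by (simp add: const_poly_dvd_iff coeff_t_act split: nat.split)
  have "t_act h r - t_elt ^ Suc i * q = (t_act h r - t_elt * r) + t_elt * (r - t_elt ^ i * q)"
    by (simp only: power_Suc right_diff_distrib mult.assoc) simp
  moreover have "[:h:] dvd (t_act h r - t_elt * r) + t_elt * (r - t_elt ^ i * q)"
    using Suc by (intro dvd_add t dvd_mult) (simp add: r_def)
  ultimately show ?case by (simp only: r_def funpow.simps o_apply)
qed simp

lemma poly_as_sum_t: "p = (\<Sum>i\<le>degree p. smult (coeff p i) (t_elt ^ i))"
  by (subst poly_as_sum_of_monoms[symmetric]) (simp add: monom_altdef)

lemma const_dvd_omult_diff: "[:h:] dvd omult h p q - p * q"
proof -
  have "p * q = (\<Sum>i\<le>degree p. smult (coeff p i) (t_elt ^ i)) * q"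
    using poly_as_sum_t[of p] by simp
  then have "omult h p q - p * q
      = (\<Sum>i\<le>degree p. [:coeff p i:] * ((t_act h ^^ i) q - t_elt ^ i * q))"
    by (simp add: omult_def sum_distrib_right sum_subtractf smult_diff_right)
  also have "[:h:] dvd \<dots>"
    by (intro dvd_sum dvd_mult const_dvd_t_act_power_diff)
  finally show ?thesis .
qed

lemma const_dvd_comm: "[:h:] dvd comm h p q"
proof -
  have "comm h p q = (omult h p q - p * q) - (omult h q p - q * p)"
    by (simp add: comm_def algebra_simps)
  then show ?thesis by (simp only:) (intro dvd_diff const_dvd_omult_diff)
qed

text \<open>
  This is the Euclidean algorithm: passing from the pair $(p, q)$ to $(q, p \bmod q)$ preserves coprimality
  and the set of linear combinations.
\<close>

lemma coprime_poly_bezout: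
  fixes p q :: "'k::field poly"
  assumes "coprime p q"
  shows "\<exists>a b. a * p + b * q = 1"
  using assms
proof (induction "euclidean_size q" arbitrary: p q rule: less_induct)
  case less
  show ?case
  proof (cases "q = 0")
    case True
    then have "p dvd 1" using less.prems by simp
    then show ?thesis using True by (metis dvd_def add.right_neutral mult.commute mult_zero_right)
  next
    case False
    have "coprime q (p mod q)"
      using less.prems False by (simp add: coprime_commute coprime_mod_left_iff)
    then obtain a b where ab: "a * q + b * (p mod q) = 1"
      using less.hyps[of "p mod q" q] False mod_size_less by blast
    have "p mod q = p - p div q * q" by (simp add: minus_div_mult_eq_mod)
    then have "b * p + (a - b * (p div q)) * q = 1"
      using ab by (simp only:) (simp add: algebra_simps)
    then show ?thesis by blast
  qed
qed

lemma coprime_poly_dvd_multD: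
  fixes p q :: "'k::field poly"
  assumes "coprime p q" "p dvd q * r"
  shows "p dvd r"
proof -
  obtain a b where "a * p + b * q = 1" using coprime_poly_bezout[OF assms(1)] by blast
  then have "r = p * (a * r) + b * (q * r)"
    by (metis (no_types) distrib_right mult.assoc mult.commute mult_1)
  then show ?thesis using assms(2) by (metis dvd_add dvd_mult dvd_triv_left)
qed

definition ore_derivations :: "'k::field poly \<Rightarrow> ('k poly poly \<Rightarrow> 'k poly poly) set" where
  "ore_derivations h = {D. (\<forall>p q. D (p + q) = D p + D q) \<and>
     (\<forall>c p. D (smult [:c:] p) = smult [:c:] (D p)) \<and>
     (\<forall>p q. D (omult h p q) = omult h (D p) q + omult h p (D q))}"

lemma comm_t_x: "comm h t_elt x_elt = [:h:]"
  by (simp add: comm_def omult_t_left omult_const_left t_act_def pderiv_pCons map_poly_pCons)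

context
  fixes h :: "'k::field poly" and D :: "'k poly poly \<Rightarrow> 'k poly poly"
  assumes D: "D \<in> ore_derivations h"
begin

lemma der_add: "D (p + q) = D p + D q"
  using D by (simp add: ore_derivations_def)

lemma der_scalar: "D (smult [:c:] p) = smult [:c:] (D p)"
  using D by (simp add: ore_derivations_def)

lemma der_omult: "D (omult h p q) = omult h (D p) q + omult h p (D q)"
  using D by (simp add: ore_derivations_def)

lemma der_0 [simp]: "D 0 = 0"
  by (metis add_cancel_right_right der_add)

lemma der_1 [simp]: "D 1 = 0"
  by (metis add_cancel_right_right der_omult omult_one_left omult_one_right)

lemma der_diff: "D (p - q) = D p - D q"
  using der_add[of "p - q" q] by (simp add: algebra_simps)

lemma der_sum: "D (\<Sum>i\<in>A. f i) = (\<Sum>i\<in>A. D (f i))"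
  by (induction A rule: infinite_finite_induct) (simp_all add: der_add)

lemma der_comm: "D (comm h p q) = comm h (D p) q + comm h p (D q)"
  by (simp add: comm_def der_diff der_omult algebra_simps)

lemma der_const: "D [:[:c:]:] = 0"
  using der_scalar[of c 1] by (simp flip: one_pCons)

lemma der_const_pCons: "D [:pCons c f:] = omult h (D x_elt) [:f:] + smult [:0, 1:] (D [:f:])"
proof -
  have "[:pCons c f:] = [:[:c:]:] + omult h x_elt [:f:]"
    by (simp add: omult_const_left)
  then show ?thesis
    by (simp only: der_add der_omult der_const) (simp add: omult_const_left)
qed

text \<open>
  Modulo the commutative quotient the chain rule $D(f(x)) = f'(x) D(x)$ holds.
\<close>

lemma const_dvd_der_const_diff: "[:h:] dvd D [:f:] - smult (pderiv f) (D x_elt)"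
proof (induction f)
  case (pCons c f)
  have "D [:pCons c f:] - smult (pderiv (pCons c f)) (D x_elt)
      = (omult h (D x_elt) [:f:] - D x_elt * [:f:]) + [:[:0, 1:]:] * (D [:f:] - smult (pderiv f) (D x_elt))"
    unfolding der_const_pCons[of c f]
    by (simp add: pderiv_pCons smult_add_left smult_diff_right algebra_simps)
  also have "[:h:] dvd \<dots>"
    by (intro dvd_add dvd_mult pCons.IH const_dvd_omult_diff)
  finally show ?case .
qed simp

text \<open>
  Square-freeness enters here. As $h$ is the commutator $[t,x]$, its image under $D$ is divisible by $h$;
  by the chain rule so is $h'(x) D(x)$, and $h'$ is invertible modulo $h$.
\<close>

lemma const_dvd_der_x:
  assumes "coprime h (pderiv h)"
  shows "[:h:] dvd D x_elt"
proof -
  have "[:h:] dvd D [:h:]"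
    by (subst comm_t_x[symmetric]) (simp only: der_comm, intro dvd_add const_dvd_comm)
  then have "[:h:] dvd D [:h:] - (D [:h:] - smult (pderiv h) (D x_elt))"
    by (intro dvd_diff const_dvd_der_const_diff)
  then have "h dvd pderiv h * coeff (D x_elt) i" for i
    by (simp add: const_poly_dvd_iff)
  then have "h dvd coeff (D x_elt) i" for i
    using assms coprime_poly_dvd_multD by blast
  then show ?thesis by (simp add: const_poly_dvd_iff)
qed

lemma der_eq_0_on_consts:
  assumes "D x_elt = 0"
  shows "D [:f:] = 0"
proof (induction f)
  case (pCons c f)
  then show ?case unfolding der_const_pCons[of c f] by (simp add: assms)
qed simp

end

lemma comm_in_derivations: "comm h b \<in> ore_derivations h"
proof -
  have "comm h b (p + q) = comm h b p + comm h b q" for p q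
    by (simp add: comm_def omult_add_left omult_add_right)
  moreover have "comm h b (smult [:c:] p) = smult [:c:] (comm h b p)" for c p
    by (simp add: comm_def omult_smult_left omult_scalar_right smult_diff_right)
  moreover have "comm h b (omult h p q) = omult h (comm h b p) q + omult h p (comm h b q)" for p q
    by (simp add: comm_def omult_assoc omult_diff_left omult_diff_right)
  ultimately show ?thesis by (simp add: ore_derivations_def)
qed

lemma diff_in_derivations:
  assumes "D \<in> ore_derivations h" "E \<in> ore_derivations h"
  shows "(\<lambda>p. D p - E p) \<in> ore_derivations h"
  using assms unfolding ore_derivations_def
  by (simp add: omult_diff_left omult_diff_right smult_diff_right)

lemma comm_add_left: "comm h (p + q) r = comm h p r + comm h q r"
  by (simp add: comm_def omult_add_left omult_add_right)

text \<open>
  Commuting with $x$ turns $a t^{n+1}$ into $(n+1) h a t^n$ up to lower terms that are again divisible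
  by $h$, so a preimage of a multiple of $h$ is found from the top coefficient downwards.
\<close>

lemma comm_x_surj:
  fixes h :: "'k::field_char_0 poly"
  assumes "[:h:] dvd q"
  shows "\<exists>b. comm h b x_elt = q"
proof -
  have "\<exists>b. comm h b x_elt = q" if "[:h:] dvd q" "\<And>i. i \<ge> n \<Longrightarrow> coeff q i = 0" for q n
    using that
  proof (induction n arbitrary: q)
    case 0
    then have "q = comm h 0 x_elt" by (simp add: comm_def poly_eq_iff)
    then show ?case by metis
  next
    case (Suc n)
    have "h dvd coeff q n" using Suc.prems(1) by (simp add: const_poly_dvd_iff)
    then obtain a where a: "coeff q n = h * a" by (elim dvdE)
    \<comment> \<open>The factor cancels the $n + 1$ from differentiating $t^{n+1}$.\<close>
    define b where "b = monom (smult (1 / of_nat (Suc n)) a) (Suc n)"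
    have "degree b \<le> Suc n" by (simp add: b_def degree_monom_le)
    moreover have "degree x_elt \<le> 0" by simp
    ultimately have deg: "degree (comm h b x_elt) \<le> n"
      and top: "coeff (comm h b x_elt) n = h * (of_nat (Suc n) * smult (1 / of_nat (Suc n)) a)"
      using comm_top_coeff[of b "Suc n" x_elt 0 n h] by (simp_all add: b_def pderiv_pCons)
    have "of_nat (Suc n) * smult (1 / of_nat (Suc n)) a = a"
      by (simp add: of_nat_poly del: of_nat_Suc)
    then have top: "coeff (comm h b x_elt) n = h * a"
      using top by (simp only:)
    define r where "r = q - comm h b x_elt"
    have "coeff r i = 0" if "i \<ge> n" for i
    proof (cases "i = n")
      case True
      then show ?thesis by (simp add: r_def top a)
    next
      case False
      then show ?thesis using that deg Suc.prems(2)[of i] by (simp add: r_def coeff_eq_0)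
    qed
    moreover have "[:h:] dvd r"
      unfolding r_def by (intro dvd_diff Suc.prems const_dvd_comm)
    ultimately obtain b' where "comm h b' x_elt = r"
      using Suc.IH by blast
    then have "comm h (b + b') x_elt = q"
      by (simp add: comm_add_left r_def)
    then show ?case by blast
  qed
  from this[OF assms, of "Suc (degree q)"] show ?thesis by (simp add: coeff_eq_0)
qed

lemma centralizer_x:
  fixes h :: "'k::field_char_0 poly"
  assumes "comm h q x_elt = 0" "h \<noteq> 0"
  shows "degree q = 0"
proof (rule ccontr)
  assume "degree q \<noteq> 0"
  then obtain k where k: "degree q = Suc k" using not0_implies_Suc by blast
  then have "coeff (comm h q x_elt) k = h * (of_nat (Suc k) * coeff q (Suc k))"
    using comm_top_coeff(2)[of q "Suc k" x_elt 0 k h] by (simp add: pderiv_pCons)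
  moreover have "coeff q (Suc k) \<noteq> 0" using k by (metis degree_0 leading_coeff_0_iff nat.distinct(1))
  ultimately show False using assms by (simp del: of_nat_Suc)
qed

text \<open>
  After an inner derivation with the same value at $x$ is subtracted, the value at $t$ commutes with $x$,
  and the centralizer of $x$ is $k[x]$.
\<close>

theorem derivation_decomposition:
  fixes h :: "'k::field_char_0 poly"
  assumes "D \<in> ore_derivations h" "coprime h (pderiv h)" "h \<noteq> 0"
  obtains b E where "E \<in> ore_derivations h" "E x_elt = 0" "degree (E t_elt) = 0"
    "D = (\<lambda>p. comm h b p + E p)"
proof -
  obtain b where b: "comm h b x_elt = D x_elt"
    using comm_x_surj[OF const_dvd_der_x[OF assms(1,2)]] by auto
  define E where "E = (\<lambda>p. D p - comm h b p)"
  have E: "E \<in> ore_derivations h"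
    unfolding E_def by (intro diff_in_derivations assms comm_in_derivations)
  have Ex: "E x_elt = 0" by (simp add: E_def b)
  have "E (comm h t_elt x_elt) = 0"
    unfolding comm_t_x by (rule der_eq_0_on_consts[OF E Ex])
  moreover have "comm h t_elt 0 = 0" by (simp add: comm_def)
  ultimately have "comm h (E t_elt) x_elt = 0"
    unfolding der_comm[OF E] Ex by simp
  then have "degree (E t_elt) = 0" using assms(3) by (rule centralizer_x)
  moreover have "D = (\<lambda>p. comm h b p + E p)" by (simp add: E_def)
  ultimately show ?thesis by (rule that[OF E Ex])
qed

lemma degree_omult_const_right: "degree (omult h q [:g:]) \<le> degree q"
  using omult_top_coeffs(1)[of q "degree q" "[:g:]" 0 h] by simp

text \<open>
  The summand $E$ of the decomposition lowers the degree in $t$, so it does not touch the leading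
  coefficients that decide the growth of orbits.
\<close>

lemma vertical_derivation_lowers_degree:
  assumes "E \<in> ore_derivations h" "E x_elt = 0" "degree (E t_elt) = 0" "degree q \<le> m" "m \<le> k"
  shows "coeff (E q) k = 0"
proof -
  obtain g where g: "E t_elt = [:g:]" using degree_eq_zeroE[OF assms(3)] .
  have monom: "coeff (E (monom 1 i)) k = 0" if "i \<le> k" for i k
    using that
  proof (induction i arbitrary: k)
    case 0
    then show ?case using der_1[OF assms(1)] by simp
  next
    case (Suc i)
    have "E (monom 1 (Suc i)) = E (omult h (monom 1 i) t_elt)"
      by (simp add: omult_t_right monom_Suc)
    also have "\<dots> = pCons 0 (E (monom 1 i)) + omult h (monom 1 i) [:g:]"
      by (subst der_omult[OF assms(1)]) (simp only: g omult_t_right)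
    finally have "E (monom 1 (Suc i)) = pCons 0 (E (monom 1 i)) + omult h (monom 1 i) [:g:]" .
    moreover have "coeff (omult h (monom 1 i) [:g:]) k = 0"
      using Suc.prems order_trans[OF degree_omult_const_right[of h "monom 1 i" g] degree_monom_le]
      by (intro coeff_eq_0) linarith
    moreover have "coeff (pCons 0 (E (monom 1 i))) k = 0"
      using Suc.IH Suc.prems by (cases k) simp_all
    ultimately show ?case by simp
  qed
  have monom_coeff: "E (monom f i) = smult f (E (monom 1 i))" for f i
  proof -
    have "E (monom f i) = E (omult h [:f:] (monom 1 i))"
      by (simp add: omult_const_left smult_monom)
    also have "\<dots> = smult f (E (monom 1 i))"
      by (subst der_omult[OF assms(1)])
         (simp add: der_eq_0_on_consts[OF assms(1,2)] omult_const_left del: monom_eq_1 smult_monom)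
    finally show ?thesis .
  qed
  have "E q = (\<Sum>i\<le>degree q. smult (coeff q i) (E (monom 1 i)))"
  proof -
    have "E q = E (\<Sum>i\<le>degree q. monom (coeff q i) i)"
      by (simp add: poly_as_sum_of_monoms)
    also have "\<dots> = (\<Sum>i\<le>degree q. E (monom (coeff q i) i))"
      by (rule der_sum[OF assms(1)])
    also have "\<dots> = (\<Sum>i\<le>degree q. smult (coeff q i) (E (monom 1 i)))"
      by (intro sum.cong refl monom_coeff)
    finally show ?thesis .
  qed
  then show ?thesis using assms(4,5) by (simp add: coeff_sum monom)
qed

section \<open>Growth of the orbit of $x$\<close>

interpretation ore: vector_space "\<lambda>(c::'k::field) (p :: 'k poly poly). smult [:c:] p"
proof
  fix a b :: 'k and p q :: "'k poly poly"
  have "[:a + b:] = [:a:] + [:b:]" by simp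
  then show "smult [:a + b:] p = smult [:a:] p + smult [:b:] p"
    by (simp only: smult_add_left)
qed (simp_all add: smult_add_right mult.commute flip: one_pCons)

text \<open>
  These spaces exhaust $k[x][t]$, so every finite-dimensional subspace lies in one of them. They turn
  local finiteness into a bound on degrees.
\<close>

definition degree_box :: "nat \<Rightarrow> 'k::field poly poly set" where
  "degree_box N = {p. degree p \<le> N \<and> (\<forall>i. degree (coeff p i) \<le> N)}"

lemma subspace_degree_box: "ore.subspace (degree_box N)"
  unfolding ore.subspace_def degree_box_def
  by (simp add: degree_add_le order_trans[OF degree_smult_le])

lemma degree_box_mono:
  assumes "M \<le> N"
  shows "degree_box M \<subseteq> degree_box N"
  by (auto simp: degree_box_def intro: le_trans[OF _ assms])

lemma in_some_degree_box: "\<exists>N. p \<in> degree_box N"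
proof -
  define M where "M = Max ((\<lambda>i. degree (coeff p i)) ` {..degree p})"
  have "degree (coeff p i) \<le> M" for i
    by (cases "i \<le> degree p") (auto simp: M_def coeff_eq_0)
  then have "p \<in> degree_box (max (degree p) M)"
    by (auto simp: degree_box_def intro: max.coboundedI2)
  then show ?thesis by blast
qed

lemma finite_span_degree_box:
  assumes "finite B"
  shows "\<exists>N. ore.span B \<subseteq> degree_box N"
proof -
  have "\<forall>p. \<exists>N. p \<in> degree_box N" using in_some_degree_box by blast
  from choice[OF this] obtain N where N: "\<forall>p :: 'a poly poly. p \<in> degree_box (N p)" ..
  have "p \<in> degree_box (Max (N ` B))" if "p \<in> B" for p
    using degree_box_mono[of "N p" "Max (N ` B)"] N assms that by auto
  then have "ore.span B \<subseteq> degree_box (Max (N ` B))"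
    by (intro ore.span_minimal subspace_degree_box) blast
  then show ?thesis ..
qed

lemma coeff_mult_pderiv_top:
  fixes p q :: "'k::field_char_0 poly"
  assumes "degree p + degree q = Suc k"
  shows "coeff (p * pderiv q) k = of_nat (degree q) * lead_coeff p * lead_coeff q"
proof (cases "degree q")
  case 0
  then show ?thesis by (auto elim: degree_eq_zeroE)
next
  case (Suc m)
  then have "k = degree p + degree (pderiv q)" using assms by (simp add: degree_pderiv)
  moreover have "lead_coeff (pderiv q) = of_nat (degree q) * lead_coeff q"
    using Suc by (simp add: degree_pderiv coeff_pderiv)
  ultimately show ?thesis by (simp only: coeff_mult_degree_sum) simp
qed

text \<open>
  The coefficient at the expected top degree is $(n \deg f - m \deg g)$ times the leading coefficients,
  which is nonzero in characteristic zero.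
\<close>

lemma degree_weighted_wronskian:
  fixes f g :: "'k::field_char_0 poly"
  assumes "f \<noteq> 0" "g \<noteq> 0" "n * degree f \<noteq> m * degree g" "degree f + degree g = Suc k"
  shows "degree (of_nat n * g * pderiv f - of_nat m * f * pderiv g) = k"
    and "of_nat n * g * pderiv f - of_nat m * f * pderiv g \<noteq> 0"
proof -
  let ?w = "of_nat n * g * pderiv f - of_nat m * f * pderiv g"
  have bound: "degree (of_nat j * p * pderiv q) \<le> k" if "degree p + degree q = Suc k"
    for j and p q :: "'k poly"
  proof (cases "degree q = 0")
    case True
    then show ?thesis by (auto elim: degree_eq_zeroE)
  next
    case False
    have "degree (of_nat j * p * pderiv q) \<le> (0 + degree p) + degree (pderiv q)"
      by (intro order_trans[OF degree_mult_le] add_mono) (simp_all add: of_nat_poly)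
    then show ?thesis using False that by (simp add: degree_pderiv)
  qed
  have "degree ?w \<le> k"
    using assms(4) by (intro degree_diff_le bound) simp_all
  moreover have "coeff ?w k = (of_nat (n * degree f) - of_nat (m * degree g)) * (lead_coeff f * lead_coeff g)"
    using coeff_mult_pderiv_top[of g f k] coeff_mult_pderiv_top[of f g k] assms(4)
    by (simp add: of_nat_poly mult.assoc algebra_simps)
  moreover have "\<dots> \<noteq> 0"
    using assms by (simp del: of_nat_mult)
  ultimately have "degree ?w \<le> k" "coeff ?w k \<noteq> 0"
    by simp_all
  then show "degree ?w = k" by (intro antisym le_degree)
  show "?w \<noteq> 0" using \<open>coeff ?w k \<noteq> 0\<close> by (metis coeff_0)
qed

text \<open>
  One application of $D$ to $f t^m$ adds $n$ to the degree in $t$ and $\deg g + \deg h - 1$ to the degree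
  of the leading coefficient, where $g$ is the leading coefficient of $b$, as long as the Poisson bracket
  does not vanish. It never does: for $b$ of degree $n$ in $t$, the difference $n \deg f - m \deg g$ is
  positive at the start and cannot decrease because $\deg h \geq 1$. The degree of $b$ in $t$ is written \<open>Suc n\<close>, so that no
  truncated subtraction occurs.
\<close>

lemma orbit_of_x_growth:
  fixes h :: "'k::field_char_0 poly"
  assumes E: "E \<in> ore_derivations h" "E x_elt = 0" "degree (E t_elt) = 0"
    and h: "degree h > 0"
    and b: "degree b = Suc n"
    and D: "D = (\<lambda>p. comm h b p + E p)"
  shows "degree ((D ^^ k) x_elt) \<le> k * n"
    and "degree (coeff ((D ^^ k) x_elt) (k * n)) = Suc (k * (degree (lead_coeff b) + degree h - 1))"
proof -
  define g where "g = lead_coeff b"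
  have "b \<noteq> 0" using b by auto
  then have g: "g \<noteq> 0" by (simp add: g_def)
  have "degree ((D ^^ k) x_elt) \<le> k * n \<and>
    degree (coeff ((D ^^ k) x_elt) (k * n)) = Suc (k * (degree g + degree h - 1))"
  proof (induction k)
    case 0
    show ?case by simp
  next
    case (Suc k)
    define q where "q = (D ^^ k) x_elt"
    define f where "f = coeff q (k * n)"
    have q: "degree q \<le> k * n" and f: "degree f = Suc (k * (degree g + degree h - 1))"
      using Suc.IH by (simp_all add: q_def f_def)
    have E0: "coeff (E q) i = 0" if "i \<ge> k * n" for i
      using vertical_derivation_lowers_degree[OF E q that] .
    have k: "Suc n + k * n = Suc (Suc k * n)" by simp
    note top = comm_top_coeff[OF eq_imp_le[OF b] q k, of h]
    have "degree (E q) \<le> Suc k * n"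
      by (intro degree_le) (auto intro!: E0)
    then have "degree (D q) \<le> Suc k * n"
      using top(1) by (simp add: D degree_add_le)
    moreover define w where "w = of_nat (Suc n) * g * pderiv f - of_nat (k * n) * f * pderiv g"
    have "coeff (D q) (Suc k * n) = h * w" unfolding w_def
      using top(2) E0[of "Suc k * n"] b by (simp add: D f_def g_def)
    moreover have "Suc n * degree f \<noteq> k * n * degree g"
    proof -
      obtain r where "degree h = Suc r" using h gr0_implies_Suc by blast
      then have "k * n * degree g \<le> Suc n * (k * (degree g + degree h - 1))"
        by (simp add: algebra_simps)
      then have "k * n * degree g < Suc n * degree f" unfolding f by simp
      then show ?thesis by simp
    qed
    then have "degree w = k * (degree g + degree h - 1) + degree g" and "w \<noteq> 0"
      unfolding w_def using f g by (intro degree_weighted_wronskian; auto)+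
    moreover have "h \<noteq> 0" using h by auto
    ultimately have "degree (coeff (D q) (Suc k * n)) = Suc (Suc k * (degree g + degree h - 1))"
      using h by (simp add: degree_mult_eq)
    with \<open>degree (D q) \<le> Suc k * n\<close> show ?case by (simp add: q_def)
  qed
  then show "degree ((D ^^ k) x_elt) \<le> k * n"
    and "degree (coeff ((D ^^ k) x_elt) (k * n)) = Suc (k * (degree (lead_coeff b) + degree h - 1))"
    by (simp_all add: g_def)
qed

text \<open>
  For $\deg h \geq 2$ these derivations kill $x$. For $\deg h = 1$ a derivation that multiplies $h$ by a
  scalar is locally finite as well.
\<close>

definition triangular_derivations :: "'k::field poly \<Rightarrow> ('k poly poly \<Rightarrow> 'k poly poly) set" where
  "triangular_derivations h = {D \<in> ore_derivations h. \<exists>c g. (c = 0 \<or> degree h = 1) \<and>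
     D x_elt = [:smult c h:] \<and> D t_elt = [:g:]}"

lemma triangular_derivationsI:
  assumes "D \<in> ore_derivations h" "c = 0 \<or> degree h = 1" "D x_elt = [:smult c h:]" "D t_elt = [:g:]"
  shows "D \<in> triangular_derivations h"
  unfolding triangular_derivations_def using assms by blast

lemma triangular_derivationsE:
  assumes "D \<in> triangular_derivations h"
  obtains c g where "D \<in> ore_derivations h" "c = 0 \<or> degree h = 1"
    "D x_elt = [:smult c h:]" "D t_elt = [:g:]"
  using assms unfolding triangular_derivations_def by blast

lemma comm_const_x: "comm h [:f:] x_elt = 0"
  by (simp add: comm_def omult_const_left)

lemma comm_const_t: "comm h [:f:] t_elt = - [:h * pderiv f:]"
  by (simp add: comm_def omult_const_left omult_t_left t_act_pCons)

lemma comm_linear_x: "comm h [:f, [:c:]:] x_elt = [:smult c h:]"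
  by (simp add: comm_def omult_pCons t_act_pCons pderiv_pCons)

lemma comm_linear_t: "comm h [:f, [:c:]:] t_elt = - [:h * pderiv f:]"
  by (simp add: comm_def omult_t_right omult_t_left t_act_pCons pderiv_pCons)

text \<open>
  Both degrees in \<open>orbit_of_x_growth\<close> grow linearly, so boundedness forces the two slopes to be zero.
\<close>

theorem locally_finite_imp_triangular:
  fixes h :: "'k::field_char_0 poly"
  assumes D: "D \<in> ore_derivations h" and h: "coprime h (pderiv h)" "degree h > 0"
    and bounded: "\<And>k. (D ^^ k) x_elt \<in> degree_box N"
  shows "D \<in> triangular_derivations h"
proof -
  have "h \<noteq> 0" using h by auto
  then obtain b E where E: "E \<in> ore_derivations h" "E x_elt = 0" "degree (E t_elt) = 0"
    and D_eq: "D = (\<lambda>p. comm h b p + E p)"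
    using derivation_decomposition[OF D h(1)] by blast
  obtain e where e: "E t_elt = [:e:]" using degree_eq_zeroE[OF E(3)] .
  show ?thesis
  proof (cases "degree b")
    case 0
    then obtain f where b: "b = [:f:]" by (rule degree_eq_zeroE)
    have "D x_elt = [:smult 0 h:]"
      by (simp add: D_eq b E(2) comm_const_x)
    moreover have "D t_elt = [:e - h * pderiv f:]"
      by (simp add: D_eq b e comm_const_t)
    moreover note D
    ultimately show ?thesis by (intro triangular_derivationsI[of D h 0]) simp_all
  next
    case (Suc n)
    define s where "s = degree (lead_coeff b) + degree h - 1"
    note growth = orbit_of_x_growth[OF E h(2) Suc D_eq, folded s_def]
    have le: "k * n \<le> N" "Suc (k * s) \<le> N" for k
    proof -
      have box: "degree ((D ^^ k) x_elt) \<le> N" "degree (coeff ((D ^^ k) x_elt) (k * n)) \<le> N"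
        using bounded[of k] by (simp_all add: degree_box_def)
      show "Suc (k * s) \<le> N" using box(2) growth(2)[of k] by simp
      have "coeff ((D ^^ k) x_elt) (k * n) \<noteq> 0" using growth(2)[of k] by auto
      then show "k * n \<le> N" using box(1) le_degree order_trans by blast
    qed
    have "n = 0" using le(1)[of "Suc N"] by (cases n) auto
    have "s = 0" using le(2)[of N] by (cases s) auto
    then have deg: "degree (lead_coeff b) = 0" "degree h = 1"
      using h(2) by (simp_all add: s_def)
    from Suc \<open>n = 0\<close> obtain a f where "b = [:f, a:]" "a \<noteq> 0"
      using degree1_coeffs by (metis One_nat_def)
    moreover from this have "degree a = 0" using deg(1) by simp
    then obtain c where "a = [:c:]" by (rule degree_eq_zeroE)
    ultimately have b: "b = [:f, [:c:]:]" by simp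
    have "D x_elt = [:smult c h:]"
      by (simp add: D_eq b E(2) comm_linear_x)
    moreover have "D t_elt = [:e - h * pderiv f:]"
      by (simp add: D_eq b e comm_linear_t)
    ultimately show ?thesis using D deg(2) by (intro triangular_derivationsI[of D h c]) simp_all
  qed
qed

section \<open>Weights and invariant spaces\<close>

lemma der_const_eq:
  assumes "D \<in> ore_derivations h" "D x_elt = [:g:]"
  shows "D [:f:] = [:g * pderiv f:]"
proof (induction f)
  case 0
  show ?case using der_0[OF assms(1)] by simp
next
  case (pCons c f)
  have "D [:pCons c f:] = omult h [:g:] [:f:] + smult [:0, 1:] (D [:f:])"
    by (simp only: der_const_pCons[OF assms(1), of c f] assms(2))
  then show ?case
    by (simp only: pCons.IH omult_const_left pderiv_pCons) (simp add: algebra_simps)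
qed

lemma der_monom_Suc:
  assumes "D \<in> ore_derivations h"
  shows "D (monom 1 (Suc i)) = pCons 0 (D (monom 1 i)) + omult h (monom 1 i) (D t_elt)"
proof -
  have "D (monom 1 (Suc i)) = D (omult h (monom 1 i) t_elt)"
    by (simp add: omult_t_right monom_Suc)
  also have "\<dots> = pCons 0 (D (monom 1 i)) + omult h (monom 1 i) (D t_elt)"
    by (subst der_omult[OF assms]) (simp only: omult_t_right)
  finally show ?thesis .
qed

lemma der_expand:
  assumes "D \<in> ore_derivations h"
  shows "D q = (\<Sum>i\<le>degree q. omult h (D [:coeff q i:]) (monom 1 i) + smult (coeff q i) (D (monom 1 i)))"
proof -
  have monom: "D (monom f i) = omult h (D [:f:]) (monom 1 i) + smult f (D (monom 1 i))" for f i
  proof -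
    have "D (monom f i) = D (omult h [:f:] (monom 1 i))"
      by (simp add: omult_const_left smult_monom)
    also have "\<dots> = omult h (D [:f:]) (monom 1 i) + smult f (D (monom 1 i))"
      by (subst der_omult[OF assms]) (simp only: omult_const_left)
    finally show ?thesis .
  qed
  have "D q = D (\<Sum>i\<le>degree q. monom (coeff q i) i)"
    by (simp add: poly_as_sum_of_monoms)
  also have "\<dots> = (\<Sum>i\<le>degree q. D (monom (coeff q i) i))"
    by (rule der_sum[OF assms])
  finally show ?thesis unfolding monom[of "coeff q _"] .
qed

lemma der_eq_0I:
  assumes "D \<in> ore_derivations h" "D x_elt = 0" "D t_elt = 0"
  shows "D q = 0"
proof -
  have "D (monom 1 i) = 0" for i
    by (induction i) (simp_all add: der_1[OF assms(1)] der_monom_Suc[OF assms(1)] assms(3))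
  then show ?thesis
    by (subst der_expand[OF assms(1)]) (simp add: der_eq_0_on_consts[OF assms(1,2)])
qed

text \<open>
  Polynomials of weight at most $M$, where $x$ has weight $1$ and $t$ has weight $N$.
\<close>

definition weight_space :: "nat \<Rightarrow> nat \<Rightarrow> 'k::field poly poly set" where
  "weight_space N M = {q. \<forall>i. coeff q i \<noteq> 0 \<longrightarrow> N * i + degree (coeff q i) \<le> M}"

lemma weight_spaceI: "(\<And>i. coeff q i \<noteq> 0 \<Longrightarrow> N * i + degree (coeff q i) \<le> M) \<Longrightarrow> q \<in> weight_space N M"
  by (simp add: weight_space_def)

lemma weight_spaceD: "q \<in> weight_space N M \<Longrightarrow> coeff q i \<noteq> 0 \<Longrightarrow> N * i + degree (coeff q i) \<le> M"
  by (simp add: weight_space_def)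

lemma weight_space_0: "0 \<in> weight_space N M"
  by (simp add: weight_space_def)

lemma weight_space_add:
  assumes "p \<in> weight_space N M" "q \<in> weight_space N M"
  shows "p + q \<in> weight_space N M"
proof (rule weight_spaceI)
  fix i
  assume "coeff (p + q) i \<noteq> 0"
  then show "N * i + degree (coeff (p + q) i) \<le> M"
    using weight_spaceD[OF assms(1), of i] weight_spaceD[OF assms(2), of i]
      degree_add_le_max[of "coeff p i" "coeff q i"]
    by (cases "coeff p i = 0"; cases "coeff q i = 0") auto
qed

lemma weight_space_sum:
  "(\<And>i. i \<in> A \<Longrightarrow> f i \<in> weight_space N M) \<Longrightarrow> sum f A \<in> weight_space N M"
  by (induction A rule: infinite_finite_induct) (simp_all add: weight_space_0 weight_space_add)

lemma weight_space_mono: "M \<le> M' \<Longrightarrow> q \<in> weight_space N M \<Longrightarrow> q \<in> weight_space N M'"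
  by (meson weight_spaceI weight_spaceD le_trans)

lemma weight_space_smult:
  assumes "q \<in> weight_space N M"
  shows "smult f q \<in> weight_space N (degree f + M)"
proof (rule weight_spaceI)
  fix i
  assume "coeff (smult f q) i \<noteq> 0"
  then have "coeff q i \<noteq> 0" by auto
  then show "N * i + degree (coeff (smult f q) i) \<le> degree f + M"
    using weight_spaceD[OF assms, of i] degree_mult_le[of f "coeff q i"] by simp
qed

lemma weight_space_pCons_0:
  assumes "q \<in> weight_space N M"
  shows "pCons 0 q \<in> weight_space N (N + M)"
  using weight_spaceD[OF assms] by (intro weight_spaceI) (auto simp: coeff_pCons split: nat.splits)

lemma subspace_weight_space: "ore.subspace (weight_space N M)"
  unfolding ore.subspace_def
  using weight_space_0 weight_space_add weight_space_smult[of _ N M "[:c:]" for c] by auto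

lemma weight_space_t_act:
  fixes q :: "'k::field_char_0 poly poly"
  assumes "q \<in> weight_space N M" "degree h \<le> Suc N"
  shows "t_act h q \<in> weight_space N (N + M)"
proof -
  have "map_poly (\<lambda>f. h * pderiv f) q \<in> weight_space N (N + M)"
  proof (rule weight_spaceI)
    fix i
    assume "coeff (map_poly (\<lambda>f. h * pderiv f) q) i \<noteq> 0"
    then have nz: "h * pderiv (coeff q i) \<noteq> 0" by (simp add: coeff_map_poly)
    then have "pderiv (coeff q i) \<noteq> 0" by auto
    then have "coeff q i \<noteq> 0" "degree (coeff q i) \<noteq> 0" by (auto simp: pderiv_eq_0_iff)
    moreover have "degree (h * pderiv (coeff q i)) \<le> degree h + (degree (coeff q i) - 1)"
      using degree_mult_le[of h "pderiv (coeff q i)"] by (simp add: degree_pderiv)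
    ultimately show "N * i + degree (coeff (map_poly (\<lambda>f. h * pderiv f) q) i) \<le> N + M"
      using weight_spaceD[OF assms(1), of i] assms(2) by (simp add: coeff_map_poly)
  qed
  then show ?thesis
    unfolding t_act_def by (intro weight_space_add weight_space_pCons_0 assms(1))
qed

lemma weight_space_omult_monom:
  fixes q :: "'k::field_char_0 poly poly"
  assumes "q \<in> weight_space N M" "degree h \<le> Suc N"
  shows "omult h (monom 1 i) q \<in> weight_space N (N * i + M)"
  using assms(1)
proof (induction i arbitrary: q M)
  case 0
  then show ?case by simp
next
  case (Suc i)
  then show ?case
    using Suc.IH[OF weight_space_t_act[OF Suc.prems assms(2)]]
    by (simp add: monom_Suc omult_pCons algebra_simps)
qed

text \<open>
  On $k[x]$ the derivation acts as $c h \partial_x$, which does not raise degrees as $c = 0$ or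
  $\deg h = 1$. On powers of $t$ it replaces one factor $t$, of weight $N$, by $g$, of weight at most
  $N$; moving $g$ to the left of the remaining powers of $t$ costs no weight if
  $\deg h \leq N + 1$.
\<close>

theorem triangular_preserves_weight_space:
  fixes h :: "'k::field_char_0 poly"
  assumes "D \<in> ore_derivations h" "D x_elt = [:smult c h:]" "c = 0 \<or> degree h = 1"
    and "D t_elt = [:g:]" "degree g \<le> N" "degree h \<le> Suc N" "q \<in> weight_space N M"
  shows "D q \<in> weight_space N M"
proof -
  have const: "[:f:] \<in> weight_space N (degree f)" for f :: "'k poly"
    by (intro weight_spaceI) (auto simp: coeff_pCons split: nat.splits)
  have monom: "D (monom 1 i) \<in> weight_space N (N * i)" for i
  proof (induction i)
    case 0
    show ?case using der_1[OF assms(1)] by (simp add: weight_space_0)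
  next
    case (Suc i)
    have "omult h (monom 1 i) [:g:] \<in> weight_space N (N * Suc i)"
      using weight_space_mono[OF _ weight_space_omult_monom[OF const assms(6)]] assms(5) by simp
    moreover have "pCons 0 (D (monom 1 i)) \<in> weight_space N (N * Suc i)"
      using weight_space_pCons_0[OF Suc.IH] by simp
    ultimately show ?case
      by (simp only: der_monom_Suc[OF assms(1)] assms(4) weight_space_add)
  qed
  have "omult h (D [:f:]) (monom 1 i) + smult f (D (monom 1 i)) \<in> weight_space N M"
    if f: "f = coeff q i" for f i
  proof (cases "f = 0")
    case True
    then show ?thesis by (simp add: der_0[OF assms(1)] weight_space_0)
  next
    case False
    then have wt: "N * i + degree f \<le> M" using weight_spaceD[OF assms(7)] f by blast
    have "smult f (D (monom 1 i)) \<in> weight_space N M"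
      using wt by (intro weight_space_mono[OF _ weight_space_smult[OF monom]]) simp
    moreover have "degree (smult c h * pderiv f) \<le> degree f"
    proof (cases "c = 0 \<or> degree f = 0")
      case True
      then show ?thesis by (auto elim: degree_eq_zeroE)
    next
      case False
      then show ?thesis
        using degree_mult_le[of h "pderiv f"] assms(3) by (simp add: degree_pderiv)
    qed
    then have "omult h (D [:f:]) (monom 1 i) \<in> weight_space N M"
      using wt
      by (intro weight_spaceI)
         (auto simp: der_const_eq[OF assms(1,2)] omult_const_left smult_monom coeff_monom simp del: mult_smult_left)
    ultimately show ?thesis by (intro weight_space_add)
  qed
  then show ?thesis
    by (subst der_expand[OF assms(1)]) (intro weight_space_sum, blast)
qed

lemma weight_space_finite_span:
  assumes "N > 0"
  shows "\<exists>B :: 'k::field poly poly set. finite B \<and> weight_space N M \<subseteq> ore.span B"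
proof -
  define B :: "'k poly poly set" where "B = (\<lambda>(i, j). monom (monom 1 j) i) ` ({..M} \<times> {..M})"
  have "q \<in> ore.span B" if q: "q \<in> weight_space N M" for q :: "'k poly poly"
  proof -
    have term_in: "monom (coeff q i) i \<in> ore.span B" for i
    proof (cases "coeff q i = 0")
      case True
      then show ?thesis by (simp add: ore.span_zero)
    next
      case False
      then have le: "N * i + degree (coeff q i) \<le> M" by (rule weight_spaceD[OF q])
      then have "N * i \<le> M" "degree (coeff q i) \<le> M" by simp_all
      moreover have "i \<le> N * i" using assms by (cases N) simp_all
      ultimately have "i \<le> M" by linarith
      have "monom (coeff q i) i = (\<Sum>j\<le>degree (coeff q i). smult [:coeff (coeff q i) j:] (monom (monom 1 j) i))"
      proof -
        have "coeff q i = (\<Sum>j\<le>degree (coeff q i). monom (coeff (coeff q i) j) j)"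
          by (simp add: poly_as_sum_of_monoms)
        then have "monom (coeff q i) i = (\<Sum>j\<le>degree (coeff q i). monom (monom (coeff (coeff q i) j) j) i)"
          by (metis (no_types, lifting) monom_sum sum.cong)
        then show ?thesis by (simp add: smult_monom)
      qed
      also have "\<dots> \<in> ore.span B"
        using \<open>i \<le> M\<close> \<open>degree (coeff q i) \<le> M\<close>
        by (intro ore.span_sum ore.span_scale ore.span_base) (auto simp: B_def)
      finally show ?thesis .
    qed
    have "(\<Sum>i\<le>degree q. monom (coeff q i) i) \<in> ore.span B"
      by (intro ore.span_sum term_in)
    then show ?thesis by (simp add: poly_as_sum_of_monoms)
  qed
  then show ?thesis by (intro exI[where x = B]) (auto simp: B_def)
qed

lemma in_some_weight_space: "\<exists>M. q \<in> weight_space N M"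
proof -
  define M where "M = Max ((\<lambda>i. N * i + degree (coeff q i)) ` {..degree q})"
  have "N * i + degree (coeff q i) \<le> M" if "coeff q i \<noteq> 0" for i
    using le_degree[OF that] by (auto simp: M_def)
  then show ?thesis using weight_spaceI by blast
qed

text \<open>
  Finitely many derivations have values at $t$ of bounded degree, so that one weight $N$ serves all of
  them.
\<close>

theorem finite_triangular_invariant_space:
  fixes h :: "'k::field_char_0 poly"
  assumes "finite F" "F \<subseteq> triangular_derivations h"
  shows "\<exists>U B. ore.subspace U \<and> finite B \<and> U \<subseteq> ore.span B \<and> q \<in> U \<and> (\<forall>D\<in>F. D ` U \<subseteq> U)"
proof -
  define N where "N = Max (insert (Suc (degree h)) ((\<lambda>D. degree (coeff (D t_elt) 0)) ` F))"
  have N: "degree h < N" "D \<in> F \<Longrightarrow> degree (coeff (D t_elt) 0) \<le> N" for D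
    using assms(1) by (auto simp: N_def Suc_le_eq[symmetric])
  obtain M where M: "q \<in> weight_space N M" using in_some_weight_space by blast
  have "0 < N" using N(1) by simp
  then obtain B :: "'k poly poly set" where B: "finite B" "weight_space N M \<subseteq> ore.span B"
    using weight_space_finite_span by blast
  have "D ` weight_space N M \<subseteq> weight_space N M" if "D \<in> F" for D
  proof -
    have "D \<in> triangular_derivations h" using that assms(2) by blast
    then obtain c g where D: "D \<in> ore_derivations h" "c = 0 \<or> degree h = 1"
        "D x_elt = [:smult c h:]" "D t_elt = [:g:]"
      by (rule triangular_derivationsE)
    moreover have "degree g \<le> N" using N(2)[OF that] D(4) by simp
    ultimately show ?thesis
      using N(1) by (auto intro!: triangular_preserves_weight_space[of D h c g N])
  qed
  then show ?thesis using subspace_weight_space M B by blast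
qed

text \<open>
  The inner derivations given by elements $f$ of $k[x]$ are triangular and map $t$ to $-h f'$.
\<close>

theorem triangular_no_common_box:
  fixes h :: "'k::field_char_0 poly"
  assumes "h \<noteq> 0"
  shows "\<exists>D \<in> triangular_derivations h. D t_elt \<notin> degree_box N"
proof -
  \<comment> \<open>Differentiation lowers the degree by one, so $h f'$ still has degree above $N$.\<close>
  define f :: "'k poly" where "f = monom 1 (N + 2)"
  have "degree f = N + 2" by (simp add: f_def degree_monom_eq)
  then have "degree (pderiv f) = N + 1" "pderiv f \<noteq> 0" by (auto simp: degree_pderiv pderiv_eq_0_iff)
  then have "degree (h * pderiv f) > N" using assms by (simp add: degree_mult_eq)
  moreover have "comm h [:f:] t_elt = [:- (h * pderiv f):]" by (simp add: comm_const_t)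
  ultimately have "comm h [:f:] t_elt \<notin> degree_box N"
    by (auto simp: degree_box_def intro!: exI[where x = 0])
  moreover have "comm h [:f:] \<in> triangular_derivations h"
    by (intro triangular_derivationsI[where c = 0 and g = "- (h * pderiv f)"] comm_in_derivations)
       (simp_all add: comm_const_x comm_const_t)
  ultimately show ?thesis by blast
qed

section \<open>The Lie algebra of triangular derivations\<close>

lemma ore_derivations_add:
  assumes "D \<in> ore_derivations h" "E \<in> ore_derivations h"
  shows "(\<lambda>p. D p + E p) \<in> ore_derivations h"
  using assms unfolding ore_derivations_def
  by (simp add: omult_add_left omult_add_right smult_add_right)

lemma ore_derivations_scale:
  assumes "D \<in> ore_derivations h"
  shows "(\<lambda>p. smult [:c:] (D p)) \<in> ore_derivations h"
  using assms unfolding ore_derivations_def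
  by (simp add: omult_smult_left omult_scalar_right smult_add_right mult.commute)

lemma ore_derivations_bracket:
  assumes "D \<in> ore_derivations h" "E \<in> ore_derivations h"
  shows "(\<lambda>p. D (E p) - E (D p)) \<in> ore_derivations h"
proof -
  note D = der_add[OF assms(1)] der_scalar[OF assms(1)] der_omult[OF assms(1)]
  note E = der_add[OF assms(2)] der_scalar[OF assms(2)] der_omult[OF assms(2)]
  have "D (E (omult h p q)) - E (D (omult h p q)) =
    omult h (D (E p) - E (D p)) q + omult h p (D (E q) - E (D q))" for p q
    by (simp add: D E omult_diff_left omult_diff_right)
  moreover have "D (E (smult [:c:] p)) - E (D (smult [:c:] p)) = smult [:c:] (D (E p) - E (D p))" for c p
    by (simp only: D E smult_diff_right)
  moreover have "D (E (p + q)) - E (D (p + q)) = (D (E p) - E (D p)) + (D (E q) - E (D q))" for p q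
    by (simp add: D E)
  ultimately show ?thesis unfolding ore_derivations_def by blast
qed

text \<open>
  This is the abelian ideal of the Lie algebra of triangular derivations that contains all brackets.
\<close>

definition vertical_derivations :: "'k::field poly \<Rightarrow> ('k poly poly \<Rightarrow> 'k poly poly) set" where
  "vertical_derivations h = {D \<in> ore_derivations h. D x_elt = 0 \<and> (\<exists>g. D t_elt = [:g:])}"

lemma vertical_derivationsI:
  "D \<in> ore_derivations h \<Longrightarrow> D x_elt = 0 \<Longrightarrow> D t_elt = [:g:] \<Longrightarrow> D \<in> vertical_derivations h"
  unfolding vertical_derivations_def by blast

lemma vertical_derivationsE:
  assumes "D \<in> vertical_derivations h"
  obtains g where "D \<in> ore_derivations h" "D x_elt = 0" "D t_elt = [:g:]"
  using assms unfolding vertical_derivations_def by blast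

lemma zero_in_vertical: "(\<lambda>p. 0) \<in> vertical_derivations h"
  by (intro vertical_derivationsI[where g = 0]) (simp_all add: ore_derivations_def)

lemma vertical_add:
  assumes "D \<in> vertical_derivations h" "E \<in> vertical_derivations h"
  shows "(\<lambda>p. D p + E p) \<in> vertical_derivations h"
  using assms
  by (elim vertical_derivationsE)
     (rule vertical_derivationsI[OF ore_derivations_add], simp_all)

lemma vertical_scale:
  assumes "D \<in> vertical_derivations h"
  shows "(\<lambda>p. smult [:c:] (D p)) \<in> vertical_derivations h"
  using assms
  by (elim vertical_derivationsE)
     (rule vertical_derivationsI[OF ore_derivations_scale], simp_all)

lemma vertical_imp_triangular: "D \<in> vertical_derivations h \<Longrightarrow> D \<in> triangular_derivations h"
  by (elim vertical_derivationsE) (rule triangular_derivationsI[where c = 0], simp_all)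

lemma triangular_add:
  assumes "D \<in> triangular_derivations h" "E \<in> triangular_derivations h"
  shows "(\<lambda>p. D p + E p) \<in> triangular_derivations h"
proof -
  obtain c g c' g' where *: "D \<in> ore_derivations h" "c = 0 \<or> degree h = 1"
    "D x_elt = [:smult c h:]" "D t_elt = [:g:]" "E \<in> ore_derivations h" "c' = 0 \<or> degree h = 1"
    "E x_elt = [:smult c' h:]" "E t_elt = [:g':]"
    using assms by (elim triangular_derivationsE)
  show ?thesis
    by (rule triangular_derivationsI[where c = "c + c'" and g = "g + g'"])
       (use * in \<open>auto simp: smult_add_left intro: ore_derivations_add\<close>)
qed

lemma triangular_scale:
  assumes "D \<in> triangular_derivations h"
  shows "(\<lambda>p. smult [:a:] (D p)) \<in> triangular_derivations h"
proof -
  obtain c g where *: "D \<in> ore_derivations h" "c = 0 \<or> degree h = 1"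
    "D x_elt = [:smult c h:]" "D t_elt = [:g:]"
    using assms by (elim triangular_derivationsE)
  show ?thesis
    by (rule triangular_derivationsI[where c = "a * c" and g = "smult a g"])
       (use * in \<open>auto simp: mult.commute intro: ore_derivations_scale\<close>)
qed

text \<open>
  On $k[x]$ a triangular derivation acts as a scalar multiple of $h \partial_x$, and these operators
  commute. Hence the bracket kills $x$.
\<close>

lemma triangular_bracket_vertical:
  assumes "D \<in> triangular_derivations h" "E \<in> triangular_derivations h"
  shows "(\<lambda>p. D (E p) - E (D p)) \<in> vertical_derivations h"
proof -
  obtain c g c' g' where *: "D \<in> ore_derivations h" "c = 0 \<or> degree h = 1"
    "D x_elt = [:smult c h:]" "D t_elt = [:g:]" "E \<in> ore_derivations h" "c' = 0 \<or> degree h = 1"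
    "E x_elt = [:smult c' h:]" "E t_elt = [:g':]"
    using assms by (elim triangular_derivationsE)
  note const = der_const_eq[OF *(1,3)] der_const_eq[OF *(5,7)]
  show ?thesis
  proof (rule vertical_derivationsI)
    show "(\<lambda>p. D (E p) - E (D p)) \<in> ore_derivations h"
      using * by (intro ore_derivations_bracket)
    show "D (E x_elt) - E (D x_elt) = 0"
      unfolding *(3,7) const by (simp add: pderiv_smult mult.commute)
    show "D (E t_elt) - E (D t_elt) = [:smult c h * pderiv g' - smult c' h * pderiv g:]"
      unfolding *(4,8) const by simp
  qed
qed

text \<open>
  Both derivations map $t$ into $k[x]$, which both of them kill. So the bracket vanishes on the two
  generators.
\<close>

lemma vertical_commute:
  assumes "D \<in> vertical_derivations h" "E \<in> vertical_derivations h"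
  shows "D (E p) - E (D p) = 0"
proof -
  obtain g g' where *: "D \<in> ore_derivations h" "D x_elt = 0" "D t_elt = [:g:]"
    "E \<in> ore_derivations h" "E x_elt = 0" "E t_elt = [:g':]"
    using assms by (elim vertical_derivationsE)
  show ?thesis
  proof (rule der_eq_0I[OF ore_derivations_bracket[OF *(1,4)]])
    show "D (E x_elt) - E (D x_elt) = 0"
      unfolding *(2,5) using der_0[OF *(1)] der_0[OF *(4)] by simp
    show "D (E t_elt) - E (D t_elt) = 0"
      unfolding *(3,6) using der_eq_0_on_consts[OF *(1,2)] der_eq_0_on_consts[OF *(4,5)] by simp
  qed
qed

section \<open>The presentation of $A_h$\<close>

abbreviation free_x :: "gen free_monoid \<Rightarrow>\<^sub>0 'k::field" where "free_x \<equiv> free_gen Gen_x"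
abbreviation free_t :: "gen free_monoid \<Rightarrow>\<^sub>0 'k::field" where "free_t \<equiv> free_gen Gen_t"

text \<open>
  The free algebra acts on $k[x][t]$, with the generator \<open>Gen_t\<close> acting by \<open>t_act\<close>. Applying
  an element to $1$ gives its normal form; this is a homomorphism for the twisted product.
\<close>

primrec gen_act :: "'k::field poly \<Rightarrow> gen \<Rightarrow> 'k poly poly \<Rightarrow> 'k poly poly" where
  "gen_act h Gen_x q = smult [:0, 1:] q"
| "gen_act h Gen_t q = t_act h q"

fun word_eval :: "'k::field poly \<Rightarrow> gen free_monoid \<Rightarrow> 'k poly poly" where
  "word_eval h (Word gs) = foldr (gen_act h) gs 1"

definition free_eval :: "'k::field poly \<Rightarrow> (gen free_monoid \<Rightarrow>\<^sub>0 'k) \<Rightarrow> 'k poly poly" where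
  "free_eval h u = (\<Sum>w\<in>Poly_Mapping.keys u. smult [:Poly_Mapping.lookup u w:] (word_eval h w))"

lemma free_eval_add: "free_eval h (u + v) = free_eval h u + free_eval h v"
  unfolding free_eval_def
  by (rule setsum_keys_plus_distrib) (simp_all add: ore.scale_left_distrib del: add_pCons)

lemma free_eval_0 [simp]: "free_eval h 0 = 0"
  by (simp add: free_eval_def)

lemma free_eval_minus: "free_eval h (- u) = - free_eval h u"
  using free_eval_add[of h u "-u"] by (simp add: eq_neg_iff_add_eq_0 add.commute)

lemma free_eval_diff: "free_eval h (u - v) = free_eval h u - free_eval h v"
  using free_eval_add[of h "u - v" v] by simp

lemma free_eval_single: "free_eval h (Poly_Mapping.single w c) = smult [:c:] (word_eval h w)"
  by (cases "c = 0") (simp_all add: free_eval_def)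

lemma sum_singles: "u = (\<Sum>w\<in>Poly_Mapping.keys u. Poly_Mapping.single w (Poly_Mapping.lookup u w))"
  by (intro poly_mapping_eqI)
     (simp add: lookup_sum lookup_single when_def sum.delta' in_keys_iff)

lemma free_induct [case_names add single]:
  fixes P :: "('w \<Rightarrow>\<^sub>0 'k::comm_monoid_add) \<Rightarrow> bool"
  assumes "\<And>u v. P u \<Longrightarrow> P v \<Longrightarrow> P (u + v)" and "\<And>w c. P (Poly_Mapping.single w c)"
  shows "P u"
proof -
  have "P 0" using assms(2)[of undefined 0] by simp
  then have "P (\<Sum>w\<in>A. Poly_Mapping.single w (c w))" for A c
    by (induction A rule: infinite_finite_induct) (auto intro: assms)
  then show ?thesis by (subst sum_singles)
qed

lemma gen_act_omult: "gen_act h g (omult h p q) = omult h (gen_act h g p) q"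
  by (cases g) (simp_all add: omult_smult_left t_act_omult)

lemma word_eval_add: "word_eval h (v + w) = omult h (word_eval h v) (word_eval h w)"
proof (cases v; cases w)
  fix gs gs' assume vw: "v = Word gs" "w = Word gs'"
  have "foldr (gen_act h) gs (foldr (gen_act h) gs' 1)
      = omult h (foldr (gen_act h) gs 1) (foldr (gen_act h) gs' 1)"
    by (induction gs) (simp_all add: gen_act_omult)
  then show ?thesis by (simp add: vw)
qed

lemma free_eval_mult: "free_eval h (u * v) = omult h (free_eval h u) (free_eval h v)"
proof (induction u rule: free_induct)
  case (single w c)
  show ?case
  proof (induction v rule: free_induct)
    case (single w' c')
    show ?case
      by (simp add: mult_single free_eval_single word_eval_add omult_smult_left omult_scalar_right mult.commute)
  qed (simp add: distrib_left free_eval_add omult_add_right)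
qed (simp add: distrib_right free_eval_add omult_add_left)

lemma free_eval_const: "free_eval h (free_const c) = [:[:c:]:]"
  by (simp add: free_const_def free_eval_single zero_free_monoid_def)

lemma free_eval_x: "free_eval h free_x = x_elt"
  by (simp add: free_gen_def free_eval_single)

lemma free_eval_t: "free_eval h free_t = t_elt"
  using t_act_monom[of h 0] by (simp add: free_gen_def free_eval_single monom_Suc)

lemma free_const_add: "free_const (a + b) = free_const a + free_const b"
  by (simp add: free_const_def single_add)

lemma free_const_mult: "free_const (a * b) = free_const a * free_const b"
  by (simp add: free_const_def mult_single)

lemma free_const_0 [simp]: "free_const 0 = 0"
  by (simp add: free_const_def)

lemma free_const_1 [simp]: "free_const 1 = 1"
  by (simp add: free_const_def)

lemma free_const_central: "u * free_const c = free_const c * u"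
  by (induction u rule: free_induct)
     (simp_all add: free_const_def mult_single distrib_left distrib_right mult.commute)

lemma free_poly_eq_sum:
  assumes "degree f \<le> n"
  shows "free_poly f = (\<Sum>i\<le>n. free_const (coeff f i) * free_x ^ i)"
  unfolding free_poly_def using assms
  by (intro sum.mono_neutral_left) (auto simp: coeff_eq_0)

lemma free_poly_add: "free_poly (f + g) = free_poly f + free_poly g"
proof -
  define n where "n = max (degree f) (degree g)"
  have "degree f \<le> n" "degree g \<le> n" "degree (f + g) \<le> n"
    by (auto simp: n_def intro: degree_add_le)
  then show ?thesis
    by (simp add: free_poly_eq_sum[of _ n] free_const_add distrib_right sum.distrib)
qed

lemma free_poly_0 [simp]: "free_poly 0 = 0"
  by (simp add: free_poly_def)

lemma free_poly_pCons: "free_poly (pCons c f) = free_const c + free_x * free_poly f"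
proof -
  have "free_poly (pCons c f) = (\<Sum>i\<le>Suc (degree f). free_const (coeff (pCons c f) i) * free_x ^ i)"
    by (intro free_poly_eq_sum degree_pCons_le)
  also have "\<dots> = free_const c + (\<Sum>i\<le>degree f. free_const (coeff f i) * free_x ^ Suc i)"
    by (simp add: sum.atMost_Suc_shift del: sum.atMost_Suc power_Suc)
  also have "(\<Sum>i\<le>degree f. free_const (coeff f i) * free_x ^ Suc i) = free_x * free_poly f"
    by (simp add: free_poly_def sum_distrib_left mult.assoc[symmetric] free_const_central)
  finally show ?thesis .
qed

lemma free_poly_smult: "free_poly (smult c f) = free_const c * free_poly f"
proof (induction f)
  case (pCons a f)
  have "free_x * (free_const c * free_poly f) = free_const c * (free_x * free_poly f)"
    by (simp only: mult.assoc[symmetric] free_const_central)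
  with pCons show ?case
    by (simp add: free_poly_pCons free_const_mult distrib_left)
qed simp

lemma free_poly_mult: "free_poly (f * g) = free_poly f * free_poly g"
  by (induction f)
     (simp_all add: mult_pCons_left free_poly_add free_poly_smult free_poly_pCons distrib_right mult.assoc)

lemma free_eval_free_poly: "free_eval h (free_poly f) = [:f:]"
  by (induction f)
     (simp_all add: free_poly_pCons free_eval_add free_eval_mult free_eval_const free_eval_x omult_const_left)

text \<open>
  This maps a normal form to the element of the free algebra that it denotes, which inverts
  \<open>free_eval\<close> up to the ideal of relations.
\<close>

definition free_section :: "'k::field poly poly \<Rightarrow> gen free_monoid \<Rightarrow>\<^sub>0 'k" where
  "free_section q = (\<Sum>i\<le>degree q. free_poly (coeff q i) * free_t ^ i)"

lemma free_section_eq_sum: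
  assumes "degree q \<le> n"
  shows "free_section q = (\<Sum>i\<le>n. free_poly (coeff q i) * free_t ^ i)"
  unfolding free_section_def using assms
  by (intro sum.mono_neutral_left) (auto simp: coeff_eq_0)

lemma free_section_add: "free_section (p + q) = free_section p + free_section q"
proof -
  define n where "n = max (degree p) (degree q)"
  have "degree p \<le> n" "degree q \<le> n" "degree (p + q) \<le> n"
    by (auto simp: n_def intro: degree_add_le)
  then show ?thesis
    by (simp add: free_section_eq_sum[of _ n] free_poly_add distrib_right sum.distrib)
qed

lemma free_section_0 [simp]: "free_section 0 = 0"
  by (simp add: free_section_def)

lemma free_section_pCons: "free_section (pCons f q) = free_poly f + free_section q * free_t"
proof -
  have "free_section (pCons f q) = (\<Sum>i\<le>Suc (degree q). free_poly (coeff (pCons f q) i) * free_t ^ i)"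
    by (intro free_section_eq_sum degree_pCons_le)
  also have "\<dots> = free_poly f + (\<Sum>i\<le>degree q. free_poly (coeff q i) * free_t ^ Suc i)"
    by (simp add: sum.atMost_Suc_shift del: sum.atMost_Suc power_Suc)
  also have "(\<Sum>i\<le>degree q. free_poly (coeff q i) * free_t ^ Suc i) = free_section q * free_t"
    by (simp add: free_section_def sum_distrib_right mult.assoc power_commutes)
  finally show ?thesis .
qed

lemma free_section_smult: "free_section (smult f q) = free_poly f * free_section q"
  by (induction q) (simp_all add: free_section_pCons free_poly_mult distrib_left mult.assoc)

lemma free_eval_section: "free_eval h (free_section q) = q"
  by (induction q)
     (simp_all add: free_section_pCons free_eval_add free_eval_mult free_eval_free_poly
        free_eval_t omult_t_right)

lemma free_eval_relator: "free_eval h (A_relator h) = 0"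
  by (simp add: A_relator_def free_eval_diff free_eval_mult free_eval_t free_eval_x free_eval_free_poly
      omult_t_left omult_const_left t_act_pCons pderiv_pCons)

lemma free_algebra_simps:
  "carrier free_algebra = UNIV"
  "monoid.mult free_algebra = (*)"
  "one free_algebra = 1"
  "ring.zero free_algebra = 0"
  "add free_algebra = (+)"
  "module.smult free_algebra = (\<lambda>c p. free_const c * p)"
  by (simp_all add: free_algebra_def ring.extend_def module.fields_def ring_of_type_algebra_def fun_eq_iff)

lemma ring_free_algebra: "ring (free_algebra :: ('k::field, 'g free_monoid \<Rightarrow>\<^sub>0 'k) module)"
proof -
  have "\<exists>y. x + y = 0" for x :: "'g free_monoid \<Rightarrow>\<^sub>0 'k"
    by (rule exI[of _ "- x"]) simp
  moreover have "\<exists>y. y + x = 0" for x :: "'g free_monoid \<Rightarrow>\<^sub>0 'k"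
    by (rule exI[of _ "- x"]) simp
  ultimately show ?thesis
    by unfold_locales (auto simp: free_algebra_simps algebra_simps Units_def)
qed

lemma free_algebra_minus:
  fixes a b :: "'g free_monoid \<Rightarrow>\<^sub>0 'k::field"
  shows "a \<ominus>\<^bsub>free_algebra\<^esub> b = a - b"
proof -
  interpret ring "free_algebra :: ('k, 'g free_monoid \<Rightarrow>\<^sub>0 'k) module" by (rule ring_free_algebra)
  have "\<ominus>\<^bsub>free_algebra\<^esub> b = - b"
    by (rule minus_equality) (simp_all add: free_algebra_simps)
  then show ?thesis by (simp add: a_minus_def free_algebra_simps)
qed

definition A_ideal :: "'k::field poly \<Rightarrow> (gen free_monoid \<Rightarrow>\<^sub>0 'k) set" where
  "A_ideal h = genideal free_algebra {A_relator h}"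

lemma ideal_A_ideal: "ideal (A_ideal h) free_algebra"
  unfolding A_ideal_def
  by (rule ring.genideal_ideal[OF ring_free_algebra]) (simp add: free_algebra_simps)

lemma A_ideal_add: "u \<in> A_ideal h \<Longrightarrow> v \<in> A_ideal h \<Longrightarrow> u + v \<in> A_ideal h"
  using additive_subgroup.a_closed[OF ideal.axioms(1)[OF ideal_A_ideal], of u h v]
  by (simp add: free_algebra_simps)

lemma A_ideal_0: "0 \<in> A_ideal h"
  using additive_subgroup.zero_closed[OF ideal.axioms(1)[OF ideal_A_ideal]]
  by (simp add: free_algebra_simps)

lemma A_ideal_mult_left: "u \<in> A_ideal h \<Longrightarrow> v * u \<in> A_ideal h"
  using ideal.I_l_closed[OF ideal_A_ideal, of u h v] by (simp add: free_algebra_simps)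

lemma A_ideal_mult_right: "u \<in> A_ideal h \<Longrightarrow> u * v \<in> A_ideal h"
  using ideal.I_r_closed[OF ideal_A_ideal, of u h v] by (simp add: free_algebra_simps)

lemma A_relator_in_ideal: "A_relator h \<in> A_ideal h"
  unfolding A_ideal_def by (rule ring.genideal_self'[OF ring_free_algebra]) (simp add: free_algebra_simps)

text \<open>
  The kernel of \<open>free_eval\<close> is an ideal that contains the relator. This is what makes normal forms
  unique.
\<close>

lemma A_ideal_eval_eq_0:
  assumes "u \<in> A_ideal h"
  shows "free_eval h u = 0"
proof -
  interpret ring "free_algebra :: ('a, gen free_monoid \<Rightarrow>\<^sub>0 'a) module" by (rule ring_free_algebra)
  have inv: "\<ominus>\<^bsub>free_algebra\<^esub> b = - b" for b :: "gen free_monoid \<Rightarrow>\<^sub>0 'a"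
    by (rule minus_equality) (simp_all add: free_algebra_simps)
  have "ideal {u. free_eval h u = 0} free_algebra"
  proof (rule idealI)
    show "subgroup {u. free_eval h u = 0} (add_monoid free_algebra)"
      by (rule add.subgroupI)
         (use inv in \<open>auto simp: free_algebra_simps free_eval_add free_eval_minus a_inv_def intro: exI[of _ 0]\<close>)
  qed (auto simp: free_algebra_simps free_eval_mult ring_free_algebra)
  then have "A_ideal h \<subseteq> {u. free_eval h u = 0}"
    unfolding A_ideal_def by (rule genideal_minimal) (simp add: free_eval_relator)
  then show ?thesis using assms by blast
qed

text \<open>
  The defining relation extends from $x$ to all polynomials in $x$, since both $f \mapsto [t,f]$ and
  $f \mapsto h f'$ are derivations.
\<close>

lemma t_free_poly_in_ideal:
  "free_t * free_poly f - free_poly f * free_t - free_poly (h * pderiv f) \<in> A_ideal h"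
proof (induction f)
  case 0
  show ?case by (simp add: A_ideal_0)
next
  case (pCons c f)
  have rel: "free_t * free_x = A_relator h + free_x * free_t + free_poly h"
    by (simp add: A_relator_def)
  have "h * pderiv (pCons c f) = h * f + pCons 0 (h * pderiv f)"
    by (simp add: pderiv_pCons distrib_left)
  then have "free_poly (h * pderiv (pCons c f)) = free_poly h * free_poly f + free_x * free_poly (h * pderiv f)"
    by (simp only: free_poly_add free_poly_mult free_poly_pCons) simp
  moreover have "free_t * (free_x * free_poly f)
      = A_relator h * free_poly f + free_x * (free_t * free_poly f) + free_poly h * free_poly f"
    by (simp only: mult.assoc[symmetric] rel distrib_right)
  ultimately have "free_t * free_poly (pCons c f) - free_poly (pCons c f) * free_t - free_poly (h * pderiv (pCons c f))
    = A_relator h * free_poly f + free_x * (free_t * free_poly f - free_poly f * free_t - free_poly (h * pderiv f))"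
    by (simp add: free_poly_pCons free_const_central algebra_simps)
  then show ?case
    using A_ideal_add[OF A_ideal_mult_right[OF A_relator_in_ideal] A_ideal_mult_left[OF pCons.IH]]
    by simp
qed

lemma t_free_section_in_ideal: "free_t * free_section q - free_section (t_act h q) \<in> A_ideal h"
proof (induction q)
  case 0
  show ?case by (simp add: A_ideal_0)
next
  case (pCons f q)
  have "free_section [:f:] = free_poly f" by (simp add: free_section_pCons)
  then have "free_t * free_section (pCons f q) - free_section (t_act h (pCons f q))
    = (free_t * free_poly f - free_poly f * free_t - free_poly (h * pderiv f))
      + (free_t * free_section q - free_section (t_act h q)) * free_t"
    by (simp add: free_section_pCons t_act_pCons free_section_add algebra_simps)
  then show ?case
    using A_ideal_add[OF t_free_poly_in_ideal A_ideal_mult_right[OF pCons.IH]] by simp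
qed

text \<open>
  Left multiplication by a generator respects congruence to a normal form: for $x$ the product is a normal
  form already, and for $t$ this is \<open>t_free_section_in_ideal\<close>. Induction on words does the rest.
\<close>

lemma normal_form: "u - free_section (free_eval h u) \<in> A_ideal h"
proof (induction u rule: free_induct)
  case (add u v)
  have "u + v - free_section (free_eval h (u + v))
      = (u - free_section (free_eval h u)) + (v - free_section (free_eval h v))"
    by (simp add: free_eval_add free_section_add)
  then show ?case using A_ideal_add[OF add] by (simp only:)
next
  case (single w c)
  obtain gs where w: "w = Word gs" by (cases w)
  show ?case unfolding w
  proof (induction gs)
    case Nil
    have "Poly_Mapping.single (Word []) c = free_poly [:c:]"
      by (simp add: free_poly_pCons free_const_def zero_free_monoid_def)
    then show ?case by (simp add: free_eval_free_poly free_section_pCons A_ideal_0)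
  next
    case (Cons g gs)
    define u where "u = (Poly_Mapping.single (Word gs) c :: gen free_monoid \<Rightarrow>\<^sub>0 'a)"
    have u: "Poly_Mapping.single (Word (g # gs)) c = free_gen g * u"
      by (simp add: u_def free_gen_def mult_single)
    have IH: "u - free_section (free_eval h u) \<in> A_ideal h"
      using Cons by (simp add: u_def)
    have "free_gen g * free_section q - free_section (free_eval h (free_gen g * free_section q)) \<in> A_ideal h" for q
    proof (cases g)
      case Gen_x
      have "free_poly [:0, 1 :: 'a:] = free_x" by (simp add: free_poly_pCons)
      then show ?thesis
        by (simp add: Gen_x free_eval_mult free_eval_x free_eval_section omult_const_left
            free_section_smult A_ideal_0)
    next
      case Gen_t
      then show ?thesis
        using t_free_section_in_ideal
        by (simp add: free_eval_mult free_eval_t free_eval_section omult_t_left)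
    qed
    from A_ideal_add[OF A_ideal_mult_left[OF IH, of "free_gen g"] this[of "free_eval h u"]]
    show ?case
      by (simp add: u free_eval_mult free_eval_section right_diff_distrib)
  qed
qed

text \<open>
  This is the isomorphism from $k[x][t]$ with the twisted product onto $A_h$.
\<close>

definition ore_to_A :: "'k::field poly \<Rightarrow> 'k poly poly \<Rightarrow> (gen free_monoid \<Rightarrow>\<^sub>0 'k) set" where
  "ore_to_A h q = A_ideal h +>\<^bsub>free_algebra\<^esub> free_section q"

lemma ore_to_A_free_eval: "A_ideal h +>\<^bsub>free_algebra\<^esub> u = ore_to_A h (free_eval h u)"
  using normal_form[of u h]
    ring.quotient_eq_iff_same_a_r_cos[OF ring_free_algebra ideal_A_ideal, of u "free_section (free_eval h u)" h]
  by (simp add: free_algebra_simps free_algebra_minus ore_to_A_def)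

lemma A_alg_simps:
  "carrier (A_alg h) = a_rcosets\<^bsub>free_algebra\<^esub> (A_ideal h)"
  "monoid.mult (A_alg h) = rcoset_mult free_algebra (A_ideal h)"
  "add (A_alg h) = set_add free_algebra"
  "ring.zero (A_alg h) = A_ideal h"
  "c \<odot>\<^bsub>A_alg h\<^esub> C = (\<Union>a\<in>C. A_ideal h +>\<^bsub>free_algebra\<^esub> (free_const c * a))"
  by (simp_all add: A_alg_def quotient_algebra_def A_ideal_def ring.extend_def module.fields_def
      FactRing_def free_algebra_simps)

lemma bij_betw_ore_to_A: "bij_betw (ore_to_A h) UNIV (carrier (A_alg h))"
proof (rule bij_betw_imageI)
  show "inj (ore_to_A h)"
  proof (rule injI)
    fix p q assume "ore_to_A h p = ore_to_A h q"
    then have "free_section p - free_section q \<in> A_ideal h"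
      using ring.quotient_eq_iff_same_a_r_cos[OF ring_free_algebra ideal_A_ideal, of "free_section p" "free_section q" h]
      by (simp add: free_algebra_simps free_algebra_minus ore_to_A_def)
    then have "free_eval h (free_section p - free_section q) = 0"
      by (rule A_ideal_eval_eq_0)
    then show "p = q" by (simp add: free_eval_diff free_eval_section)
  qed
  show "range (ore_to_A h) = carrier (A_alg h)"
  proof -
    have "carrier (A_alg h) = range (\<lambda>u. A_ideal h +>\<^bsub>free_algebra\<^esub> u)"
      by (auto simp: A_alg_simps A_RCOSETS_def' free_algebra_simps a_r_coset_def')
    also have "\<dots> = range (ore_to_A h)"
    proof
      show "range (\<lambda>u. A_ideal h +>\<^bsub>free_algebra\<^esub> u) \<subseteq> range (ore_to_A h)"
        by (auto simp: ore_to_A_free_eval)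
      show "range (ore_to_A h) \<subseteq> range (\<lambda>u. A_ideal h +>\<^bsub>free_algebra\<^esub> u)"
        by (auto simp: ore_to_A_def)
    qed
    finally show ?thesis by simp
  qed
qed

lemma ore_to_A_add: "ore_to_A h (p + q) = ore_to_A h p \<oplus>\<^bsub>A_alg h\<^esub> ore_to_A h q"
proof -
  have "ore_to_A h p \<oplus>\<^bsub>A_alg h\<^esub> ore_to_A h q
      = A_ideal h +>\<^bsub>free_algebra\<^esub> (free_section p + free_section q)"
    using ideal.a_rcos_sum[OF ideal_A_ideal, of "free_section p" "free_section q" h]
    by (simp add: A_alg_simps ore_to_A_def free_algebra_simps)
  then show ?thesis by (simp add: ore_to_A_def free_section_add)
qed

lemma ore_to_A_mult: "ore_to_A h (omult h p q) = ore_to_A h p \<otimes>\<^bsub>A_alg h\<^esub> ore_to_A h q"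
proof -
  have "ore_to_A h p \<otimes>\<^bsub>A_alg h\<^esub> ore_to_A h q
      = A_ideal h +>\<^bsub>free_algebra\<^esub> (free_section p * free_section q)"
    using ideal.rcoset_mult_add[OF ideal_A_ideal, of "free_section p" "free_section q" h]
    by (simp add: A_alg_simps ore_to_A_def free_algebra_simps)
  also have "\<dots> = ore_to_A h (omult h p q)"
    by (simp add: ore_to_A_free_eval free_eval_mult free_eval_section)
  finally show ?thesis by simp
qed

lemma ore_to_A_smult: "ore_to_A h (smult [:c:] q) = c \<odot>\<^bsub>A_alg h\<^esub> ore_to_A h q"
proof -
  have "A_ideal h +>\<^bsub>free_algebra\<^esub> (free_const c * a) = ore_to_A h (smult [:c:] q)"
    if "a \<in> ore_to_A h q" for a
  proof -
    obtain i where i: "i \<in> A_ideal h" "a = i + free_section q"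
      using \<open>a \<in> ore_to_A h q\<close> by (auto simp: ore_to_A_def a_r_coset_def' free_algebra_simps)
    then have "free_eval h a = q"
      by (simp add: free_eval_add A_ideal_eval_eq_0 free_eval_section)
    then show ?thesis
      by (simp add: ore_to_A_free_eval free_eval_mult free_eval_const omult_const_left)
  qed
  moreover have "free_section q \<in> ore_to_A h q"
    using A_ideal_0[of h] by (force simp: ore_to_A_def a_r_coset_def' free_algebra_simps)
  ultimately show ?thesis by (auto simp: A_alg_simps)
qed

section \<open>Algebras in coordinates\<close>

lemma subspace_ofI:
  assumes "abelian_group M" "U \<subseteq> carrier M" "\<zero>\<^bsub>M\<^esub> \<in> U"
    and add: "\<And>u v. u \<in> U \<Longrightarrow> v \<in> U \<Longrightarrow> u \<oplus>\<^bsub>M\<^esub> v \<in> U"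
    and smult: "\<And>c u. u \<in> U \<Longrightarrow> c \<odot>\<^bsub>M\<^esub> u \<in> U"
    and minus: "\<And>u. u \<in> U \<Longrightarrow> (- 1) \<odot>\<^bsub>M\<^esub> u \<oplus>\<^bsub>M\<^esub> u = \<zero>\<^bsub>M\<^esub>"
  shows "subspace_of U M"
proof -
  interpret abelian_group M by fact
  have "\<ominus>\<^bsub>M\<^esub> u = (- 1) \<odot>\<^bsub>M\<^esub> u" if "u \<in> U" for u
    using that assms(2) smult by (intro minus_equality minus) auto
  then have "inv\<^bsub>add_monoid M\<^esub> u \<in> U" if "u \<in> U" for u
    using that smult by (simp add: a_inv_def)
  then show ?thesis
    using assms by (intro submodule.intro subgroup.intro submodule_axioms.intro) auto
qed

lemma subspace_ofD:
  assumes "subspace_of U M"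
  shows "U \<subseteq> carrier M" "\<zero>\<^bsub>M\<^esub> \<in> U"
    and "\<And>u v. u \<in> U \<Longrightarrow> v \<in> U \<Longrightarrow> u \<oplus>\<^bsub>M\<^esub> v \<in> U"
    and "\<And>c u. u \<in> U \<Longrightarrow> c \<odot>\<^bsub>M\<^esub> u \<in> U"
proof -
  have sg: "subgroup U (add_monoid M)" using assms by (rule submodule.axioms)
  show "U \<subseteq> carrier M" "\<zero>\<^bsub>M\<^esub> \<in> U"
    "\<And>u v. u \<in> U \<Longrightarrow> v \<in> U \<Longrightarrow> u \<oplus>\<^bsub>M\<^esub> v \<in> U"
    using subgroup.subset[OF sg] subgroup.one_closed[OF sg] subgroup.m_closed[OF sg] by simp_all
  show "\<And>c u. u \<in> U \<Longrightarrow> c \<odot>\<^bsub>M\<^esub> u \<in> U"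
    using submodule.smult_closed[OF assms] by (simp add: ring_of_type_algebra_def)
qed

lemma span_of_subset: "subspace_of U M \<Longrightarrow> S \<subseteq> U \<Longrightarrow> span_of M S \<subseteq> U"
  by (auto simp: span_of_def)

lemma zero_in_span_of: "\<zero>\<^bsub>M\<^esub> \<in> span_of M S"
  by (auto simp: span_of_def dest: subspace_ofD(2))

text \<open>
  An algebra given by a record is identified with a vector space on a whole type, along an isomorphism
  \<open>coord\<close>. Subspaces, linear maps, derivations and local finiteness are then expressed by the
  vector space alone, without carriers and extensional functions.
\<close>

locale algebra_coordinates = vector_space scale
  for scale :: "'k::field \<Rightarrow> 'b::ab_group_add \<Rightarrow> 'b" (infixr \<open>*s\<close> 75) +
  fixes mul :: "'b \<Rightarrow> 'b \<Rightarrow> 'b" and A :: "('k, 'a) module" and coord :: "'b \<Rightarrow> 'a"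
  assumes bij_coord: "bij_betw coord UNIV (carrier A)"
    and coord_zero: "\<zero>\<^bsub>A\<^esub> = coord 0"
    and coord_add: "coord p \<oplus>\<^bsub>A\<^esub> coord q = coord (p + q)"
    and coord_mult: "coord p \<otimes>\<^bsub>A\<^esub> coord q = coord (mul p q)"
    and coord_smult: "c \<odot>\<^bsub>A\<^esub> coord p = coord (c *s p)"
begin

lemma coord_inj [simp]: "coord p = coord q \<longleftrightarrow> p = q"
  using bij_coord by (auto simp: bij_betw_def inj_eq)

lemma inj_coord: "inj coord"
  using bij_coord by (simp add: bij_betw_def)

lemma carrier_eq: "carrier A = range coord"
  using bij_coord by (auto simp: bij_betw_def)

lemma ball_carrier [simp]: "(\<forall>a\<in>carrier A. P a) \<longleftrightarrow> (\<forall>p. P (coord p))"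
  by (auto simp: carrier_eq)

lemma coord_in_carrier [simp]: "coord p \<in> carrier A"
  by (simp add: carrier_eq)

lemma coord_image_iff [simp]: "coord p \<in> coord ` U \<longleftrightarrow> p \<in> U"
  by auto

lemma abelian_group_A: "abelian_group A"
proof (rule abelian_groupI)
  fix a assume "a \<in> carrier A"
  then obtain p where "a = coord p" by (auto simp: carrier_eq)
  then show "\<exists>b\<in>carrier A. b \<oplus>\<^bsub>A\<^esub> a = \<zero>\<^bsub>A\<^esub>"
    by (intro bexI[of _ "coord (- p)"]) (simp_all add: coord_add coord_zero)
qed (auto simp: carrier_eq coord_add coord_zero add_ac)

lemma subspace_of_iff: "subspace_of (coord ` U) A \<longleftrightarrow> subspace U"
proof
  assume U: "subspace_of (coord ` U) A"
  have "0 \<in> U" using subspace_ofD(2)[OF U] by (simp add: coord_zero)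
  moreover have "p + q \<in> U" if "p \<in> U" "q \<in> U" for p q
    using subspace_ofD(3)[OF U, of "coord p" "coord q"] that by (simp add: coord_add)
  moreover have "c *s p \<in> U" if "p \<in> U" for c p
    using subspace_ofD(4)[OF U, of "coord p" c] that by (simp add: coord_smult)
  ultimately show "subspace U" by (simp add: subspace_def)
next
  assume "subspace U"
  then show "subspace_of (coord ` U) A"
    by (intro subspace_ofI abelian_group_A)
       (auto simp: subspace_def coord_zero coord_add coord_smult)
qed

lemma subspace_of_cases:
  assumes "subspace_of V A"
  obtains U where "V = coord ` U" "subspace U"
proof -
  have "V \<subseteq> range coord" using subspace_ofD(1)[OF assms] by (simp add: carrier_eq)
  then obtain U where "V = coord ` U" by (auto simp: subset_image_iff)
  then show ?thesis using that assms subspace_of_iff by blast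
qed

lemma span_of_coord: "span_of A (coord ` S) = coord ` span S"
proof
  show "span_of A (coord ` S) \<subseteq> coord ` span S"
    by (intro span_of_subset image_mono span_superset) (simp add: subspace_of_iff)
  show "coord ` span S \<subseteq> span_of A (coord ` S)"
    unfolding span_of_def
  proof (rule Inter_greatest)
    fix V assume V: "V \<in> {U. subspace_of U A \<and> coord ` S \<subseteq> U}"
    then obtain U where U: "V = coord ` U" "subspace U" by (auto elim: subspace_of_cases)
    then have "S \<subseteq> U" using V by auto
    then show "coord ` span S \<subseteq> V" using U span_minimal by blast
  qed
qed

text \<open>
  Subspaces of finite-dimensional spaces are finite-dimensional, so the finite set on the right-hand side may
  span a larger space than $U$.
\<close>

lemma fin_dim_subspace_iff:
  "fin_dim_subspace A (coord ` U) \<longleftrightarrow> subspace U \<and> (\<exists>B. finite B \<and> U \<subseteq> span B)"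
proof
  assume *: "fin_dim_subspace A (coord ` U)"
  then obtain B where B: "finite B" "B \<subseteq> coord ` U" "coord ` U = span_of A B"
    by (auto simp: fin_dim_subspace_def)
  from finite_subset_image[OF B(1,2)] obtain B' where B': "finite B'" "B = coord ` B'" by blast
  then have "coord ` U = coord ` span B'" using B(3) span_of_coord by simp
  then have "U \<subseteq> span B'" by (simp add: inj_image_eq_iff[OF inj_coord])
  with * B' show "subspace U \<and> (\<exists>B. finite B \<and> U \<subseteq> span B)"
    by (auto simp: fin_dim_subspace_def subspace_of_iff)
next
  assume *: "subspace U \<and> (\<exists>B. finite B \<and> U \<subseteq> span B)"
  then obtain B where B: "finite B" "U \<subseteq> span B" by blast
  obtain B' where B': "B' \<subseteq> U" "independent B'" "U \<subseteq> span B'"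
    using maximal_independent_subset by blast
  then have "B' \<subseteq> span B" using B by blast
  then have "finite B'" using independent_span_bound[OF B(1) B'(2)] by blast
  moreover have "U = span B'" using B' * span_minimal by blast
  ultimately show "fin_dim_subspace A (coord ` U)"
    unfolding fin_dim_subspace_def using * B'(1) span_of_coord
    by (intro conjI exI[of _ "coord ` B'"]) (auto simp: subspace_of_iff)
qed

text \<open>
  The map on the carrier that \<open>F\<close> describes in these coordinates. It is made extensional, since the
  carrier of \<open>End_alg\<close> consists of extensional functions.
\<close>

definition lift_end :: "('b \<Rightarrow> 'b) \<Rightarrow> 'a \<Rightarrow> 'a" where
  "lift_end F = (\<lambda>a\<in>carrier A. coord (F (inv_into UNIV coord a)))"

lemma lift_end_coord [simp]: "lift_end F (coord p) = coord (F p)"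
  by (simp add: lift_end_def inv_f_f inj_def)

lemma end_eqI:
  assumes "D \<in> extensional (carrier A)" "D' \<in> extensional (carrier A)" "\<And>p. D (coord p) = D' (coord p)"
  shows "D = D'"
  using assms by (intro extensionalityI[of D "carrier A"]) (auto simp: carrier_eq)

lemma lift_end_extensional [simp]: "lift_end F \<in> extensional (carrier A)"
  by (simp add: lift_end_def)

lemma lift_end_mult: "lift_end F \<otimes>\<^bsub>End_alg A\<^esub> lift_end G = lift_end (\<lambda>p. F (G p))"
  by (rule end_eqI) (simp_all add: End_alg_def compose_def)

lemma lift_end_add: "lift_end F \<oplus>\<^bsub>End_alg A\<^esub> lift_end G = lift_end (\<lambda>p. F p + G p)"
  by (rule end_eqI) (simp_all add: End_alg_def coord_add)

lemma lift_end_smult: "c \<odot>\<^bsub>End_alg A\<^esub> lift_end F = lift_end (\<lambda>p. c *s F p)"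
  by (rule end_eqI) (simp_all add: End_alg_def coord_smult)

lemma lift_end_zero: "\<zero>\<^bsub>End_alg A\<^esub> = lift_end (\<lambda>p. 0)"
  by (rule end_eqI) (simp_all add: End_alg_def coord_zero)

definition linear_ends :: "('b \<Rightarrow> 'b) set" where
  "linear_ends = {F. (\<forall>p q. F (p + q) = F p + F q) \<and> (\<forall>c p. F (c *s p) = c *s F p)}"

lemma carrier_End: "carrier (End_alg A) = lift_end ` linear_ends"
proof (intro equalityI subsetI)
  fix D assume D: "D \<in> carrier (End_alg A)"
  then have "D \<in> carrier A \<rightarrow>\<^sub>E carrier A" by (simp add: End_alg_def)
  then have ext: "D \<in> extensional (carrier A)" and "\<forall>p. D (coord p) \<in> range coord"
    by (auto simp: PiE_def Pi_def carrier_eq)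
  then have "\<forall>p. \<exists>q. D (coord p) = coord q" by blast
  from choice[OF this] obtain F where F: "\<forall>p. D (coord p) = coord (F p)" ..
  have "F \<in> linear_ends"
    using D by (auto simp: End_alg_def linear_ends_def F coord_add coord_smult)
  moreover have "D = lift_end F" by (rule end_eqI) (simp_all add: ext F)
  ultimately show "D \<in> lift_end ` linear_ends" by blast
next
  fix D assume "D \<in> lift_end ` linear_ends"
  then obtain F where F: "F \<in> linear_ends" "D = lift_end F" by blast
  have "lift_end F \<in> carrier A \<rightarrow>\<^sub>E carrier A"
    by (rule PiE_I) (auto simp: carrier_eq lift_end_def)
  then show "D \<in> carrier (End_alg A)"
    using F by (simp add: End_alg_def linear_ends_def coord_add coord_smult)
qed

lemma abelian_group_End: "abelian_group (End_alg A)"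
proof (rule abelian_groupI)
  show "\<zero>\<^bsub>End_alg A\<^esub> \<in> carrier (End_alg A)"
    by (auto simp: carrier_End lift_end_zero linear_ends_def)
next
  fix D D' assume "D \<in> carrier (End_alg A)" "D' \<in> carrier (End_alg A)"
  then show "D \<oplus>\<^bsub>End_alg A\<^esub> D' \<in> carrier (End_alg A)"
    by (auto simp: carrier_End lift_end_add linear_ends_def scale_right_distrib)
next
  fix D assume "D \<in> carrier (End_alg A)"
  then obtain F where F: "F \<in> linear_ends" "D = lift_end F" by (auto simp: carrier_End)
  then have "(\<lambda>p. - F p) \<in> linear_ends" by (simp add: linear_ends_def)
  moreover have "lift_end (\<lambda>p. - F p) \<oplus>\<^bsub>End_alg A\<^esub> D = \<zero>\<^bsub>End_alg A\<^esub>"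
    by (simp add: F lift_end_add lift_end_zero)
  ultimately show "\<exists>D'\<in>carrier (End_alg A). D' \<oplus>\<^bsub>End_alg A\<^esub> D = \<zero>\<^bsub>End_alg A\<^esub>"
    by (auto simp: carrier_End)
qed (auto simp: carrier_End lift_end_add lift_end_zero add_ac)

lemma subspace_of_lift_end:
  assumes "S \<subseteq> linear_ends" "(\<lambda>p. 0) \<in> S"
    and "\<And>F G. F \<in> S \<Longrightarrow> G \<in> S \<Longrightarrow> (\<lambda>p. F p + G p) \<in> S"
    and "\<And>c F. F \<in> S \<Longrightarrow> (\<lambda>p. c *s F p) \<in> S"
  shows "subspace_of (lift_end ` S) (End_alg A)"
  using assms
  by (intro subspace_ofI abelian_group_End)
     (auto simp: carrier_End lift_end_zero lift_end_add lift_end_smult)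

lemma commutator_lift_end:
  assumes "F \<in> linear_ends" "G \<in> linear_ends"
  shows "commutator (End_alg A) (lift_end F) (lift_end G) = lift_end (\<lambda>p. F (G p) - G (F p))"
proof -
  interpret abelian_group "End_alg A" by (rule abelian_group_End)
  have "(\<lambda>p. G (F p)) \<in> linear_ends" "(\<lambda>p. - G (F p)) \<in> linear_ends"
    using assms by (simp_all add: linear_ends_def)
  then have "\<ominus>\<^bsub>End_alg A\<^esub> lift_end (\<lambda>p. G (F p)) = lift_end (\<lambda>p. - G (F p))"
    by (intro minus_equality) (auto simp: carrier_End lift_end_add lift_end_zero)
  then show ?thesis
    by (simp add: commutator_def a_minus_def lift_end_mult lift_end_add)
qed

definition mul_derivations :: "('b \<Rightarrow> 'b) set" where
  "mul_derivations = {F \<in> linear_ends. \<forall>p q. F (mul p q) = mul (F p) q + mul p (F q)}"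

lemma Der_eq: "Der A = lift_end ` mul_derivations"
proof -
  have "lift_end F \<in> Der A \<longleftrightarrow> F \<in> mul_derivations" if "F \<in> linear_ends" for F
    using that by (auto simp: Der_def mul_derivations_def carrier_End coord_mult coord_add)
  moreover have "Der A \<subseteq> lift_end ` linear_ends" "mul_derivations \<subseteq> linear_ends"
    by (auto simp: Der_def carrier_End mul_derivations_def)
  ultimately show ?thesis by blast
qed

lemma lift_end_power: "(lift_end F ^^ n) (coord p) = coord ((F ^^ n) p)"
  by (induction n) simp_all

lemma locally_finite_der_lift_end:
  "locally_finite_der A (lift_end F) \<longleftrightarrow> (\<forall>p. \<exists>B. finite B \<and> range (\<lambda>n. (F ^^ n) p) \<subseteq> span B)"
proof -
  have orbit: "range (\<lambda>n. (lift_end F ^^ n) (coord p)) = coord ` range (\<lambda>n. (F ^^ n) p)" for p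
    by (auto simp: lift_end_power)
  have "span S \<subseteq> span B \<longleftrightarrow> S \<subseteq> span B" for S B :: "'b set"
    using span_superset span_minimal subspace_span by blast
  then show ?thesis
    by (simp add: locally_finite_der_def orbit span_of_coord fin_dim_subspace_iff)
qed

lemma locally_finite_set_lift_end:
  "locally_finite_set A (lift_end ` \<Delta>) \<longleftrightarrow>
    (\<forall>p. \<exists>U B. subspace U \<and> finite B \<and> U \<subseteq> span B \<and> p \<in> U \<and> (\<forall>F\<in>\<Delta>. F ` U \<subseteq> U))"
proof -
  have inv: "lift_end F ` (coord ` U) \<subseteq> coord ` U \<longleftrightarrow> F ` U \<subseteq> U" for F U
  proof -
    have "lift_end F ` (coord ` U) = coord ` (F ` U)" by (simp add: image_image)
    then show ?thesis by (simp only: inj_image_subset_iff[OF inj_coord])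
  qed
  have "(\<exists>V. fin_dim_subspace A V \<and> coord p \<in> V \<and> (\<forall>D\<in>lift_end ` \<Delta>. D ` V \<subseteq> V)) \<longleftrightarrow>
    (\<exists>U B. subspace U \<and> finite B \<and> U \<subseteq> span B \<and> p \<in> U \<and> (\<forall>F\<in>\<Delta>. F ` U \<subseteq> U))" for p
  proof
    assume "\<exists>V. fin_dim_subspace A V \<and> coord p \<in> V \<and> (\<forall>D\<in>lift_end ` \<Delta>. D ` V \<subseteq> V)"
    then obtain V where V: "fin_dim_subspace A V" "coord p \<in> V" "\<forall>D\<in>lift_end ` \<Delta>. D ` V \<subseteq> V" by blast
    then obtain U where U: "V = coord ` U" by (auto simp: fin_dim_subspace_def elim: subspace_of_cases)
    show "\<exists>U B. subspace U \<and> finite B \<and> U \<subseteq> span B \<and> p \<in> U \<and> (\<forall>F\<in>\<Delta>. F ` U \<subseteq> U)"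
      using V unfolding U fin_dim_subspace_iff by (simp add: inv) blast
  next
    assume "\<exists>U B. subspace U \<and> finite B \<and> U \<subseteq> span B \<and> p \<in> U \<and> (\<forall>F\<in>\<Delta>. F ` U \<subseteq> U)"
    then obtain U B where "subspace U" "finite B" "U \<subseteq> span B" "p \<in> U" "\<forall>F\<in>\<Delta>. F ` U \<subseteq> U" by blast
    then have "fin_dim_subspace A (coord ` U) \<and> coord p \<in> coord ` U \<and>
        (\<forall>D\<in>lift_end ` \<Delta>. D ` (coord ` U) \<subseteq> coord ` U)"
      by (simp add: fin_dim_subspace_iff inv) blast
    then show "\<exists>V. fin_dim_subspace A V \<and> coord p \<in> V \<and> (\<forall>D\<in>lift_end ` \<Delta>. D ` V \<subseteq> V)" by blast
  qed
  then show ?thesis by (simp add: locally_finite_set_def)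
qed

end

section \<open>Locally finite derivations of $A_h$\<close>

lemma algebra_coordinates_A_alg:
  "algebra_coordinates (\<lambda>c. smult [:c:]) (omult h) (A_alg h) (ore_to_A h)"
proof
  have "ore_to_A h 0 \<oplus>\<^bsub>A_alg h\<^esub> ore_to_A h 0 = ore_to_A h 0"
    using ore_to_A_add[of h 0 0] by simp
  show "\<zero>\<^bsub>A_alg h\<^esub> = ore_to_A h 0"
    using A_ideal_0[of h] by (auto simp: A_alg_simps ore_to_A_def a_r_coset_def' free_algebra_simps)
qed (simp_all add: bij_betw_ore_to_A ore_to_A_add ore_to_A_mult ore_to_A_smult)

context
  fixes h :: "'k::field_char_0 poly"
  assumes h: "degree h > 0" "coprime h (pderiv h)"
begin

interpretation algebra_coordinates "\<lambda>c. smult [:c:]" "omult h" "A_alg h" "ore_to_A h"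
  by (rule algebra_coordinates_A_alg)

lemma mul_derivations_eq: "mul_derivations = ore_derivations h"
  by (auto simp: mul_derivations_def linear_ends_def ore_derivations_def)

lemma ore_derivations_linear: "ore_derivations h \<subseteq> linear_ends"
  by (auto simp: linear_ends_def ore_derivations_def)

text \<open>
  A locally finite derivation has a bounded orbit at $x$, which makes it triangular. A triangular
  derivation leaves stable a finite-dimensional space through any given element, which contains the orbit.
\<close>

lemma LFD_eq: "LFD (A_alg h) = lift_end ` triangular_derivations h"
proof -
  have "locally_finite_der (A_alg h) (lift_end D) \<longleftrightarrow> D \<in> triangular_derivations h"
    if D: "D \<in> ore_derivations h" for D
  proof
    assume "locally_finite_der (A_alg h) (lift_end D)"
    then obtain B where B: "finite B" "range (\<lambda>n. (D ^^ n) x_elt) \<subseteq> ore.span B"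
      by (auto simp: locally_finite_der_lift_end)
    obtain N where "ore.span B \<subseteq> degree_box N" using finite_span_degree_box[OF B(1)] by blast
    then have "(D ^^ k) x_elt \<in> degree_box N" for k using B(2) by blast
    then show "D \<in> triangular_derivations h"
      using locally_finite_imp_triangular[OF D h(2,1)] by blast
  next
    assume D: "D \<in> triangular_derivations h"
    have "\<exists>B. finite B \<and> range (\<lambda>n. (D ^^ n) p) \<subseteq> ore.span B" for p
    proof -
      have "finite {D}" "{D} \<subseteq> triangular_derivations h" using D by auto
      from finite_triangular_invariant_space[OF this, of p]
      obtain U B where U: "finite B" "U \<subseteq> ore.span B" "p \<in> U" "D ` U \<subseteq> U" by auto
      have "(D ^^ n) p \<in> U" for n by (induction n) (use U in auto)
      then show ?thesis using U by blast
    qed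
    then show "locally_finite_der (A_alg h) (lift_end D)"
      by (simp add: locally_finite_der_lift_end)
  qed
  moreover have "triangular_derivations h \<subseteq> ore_derivations h"
    by (auto simp: triangular_derivations_def)
  ultimately show ?thesis
    by (auto simp: LFD_def Der_eq mul_derivations_eq)
qed

lemma triangular_linear: "triangular_derivations h \<subseteq> linear_ends"
  using ore_derivations_linear by (auto simp: triangular_derivations_def)

lemma vertical_linear: "vertical_derivations h \<subseteq> linear_ends"
  using ore_derivations_linear by (auto simp: vertical_derivations_def)

lemma LFD_lie_subalgebra: "lie_subalgebra (End_alg (A_alg h)) (Der (A_alg h)) (LFD (A_alg h))"
  unfolding lie_subalgebra_def
proof (intro conjI ballI)
  show "LFD (A_alg h) \<subseteq> Der (A_alg h)" by (auto simp: LFD_def)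
  show "subspace_of (LFD (A_alg h)) (End_alg (A_alg h))"
    unfolding LFD_eq
    by (intro subspace_of_lift_end triangular_linear triangular_add triangular_scale
        vertical_imp_triangular[OF zero_in_vertical])
  fix a b assume "a \<in> LFD (A_alg h)" "b \<in> LFD (A_alg h)"
  then show "commutator (End_alg (A_alg h)) a b \<in> LFD (A_alg h)"
    using triangular_linear
    by (auto simp: LFD_eq commutator_lift_end subset_iff
        intro!: imageI vertical_imp_triangular triangular_bracket_vertical)
qed

text \<open>
  The first derived algebra lies in the vertical derivations, which commute; the second is therefore zero.
\<close>

lemma LFD_solvable: "lie_solvable (End_alg (A_alg h)) (LFD (A_alg h))"
proof -
  let ?E = "End_alg (A_alg h)"
  have 1: "derived_series ?E (LFD (A_alg h)) (Suc 0) \<subseteq> lift_end ` vertical_derivations h"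
    unfolding derived_series.simps
  proof (rule span_of_subset)
    show "subspace_of (lift_end ` vertical_derivations h) ?E"
      by (intro subspace_of_lift_end vertical_linear vertical_add vertical_scale zero_in_vertical)
    show "{commutator ?E a b |a b. a \<in> LFD (A_alg h) \<and> b \<in> LFD (A_alg h)} \<subseteq> lift_end ` vertical_derivations h"
      using triangular_linear
      by (auto simp: LFD_eq commutator_lift_end subset_iff intro!: imageI triangular_bracket_vertical)
  qed
  have "derived_series ?E (LFD (A_alg h)) (Suc (Suc 0)) \<subseteq> {\<zero>\<^bsub>?E\<^esub>}"
    unfolding derived_series.simps(2)[of _ _ "Suc 0"]
  proof (rule span_of_subset)
    have "subspace_of (lift_end ` {\<lambda>p. 0}) ?E"
      by (rule subspace_of_lift_end) (auto simp: linear_ends_def)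
    then show "subspace_of {\<zero>\<^bsub>?E\<^esub>} ?E" by (simp add: lift_end_zero)
    have "commutator ?E a b = \<zero>\<^bsub>?E\<^esub>"
      if "a \<in> lift_end ` vertical_derivations h" "b \<in> lift_end ` vertical_derivations h" for a b
      using that vertical_linear
      by (auto simp: commutator_lift_end vertical_commute lift_end_zero subset_iff)
    then show "{commutator ?E a b |a b. a \<in> derived_series ?E (LFD (A_alg h)) (Suc 0) \<and>
        b \<in> derived_series ?E (LFD (A_alg h)) (Suc 0)} \<subseteq> {\<zero>\<^bsub>?E\<^esub>}"
      using 1 by blast
  qed
  moreover have "\<zero>\<^bsub>?E\<^esub> \<in> derived_series ?E (LFD (A_alg h)) (Suc (Suc 0))"
    by (simp add: zero_in_span_of)
  ultimately have "derived_series ?E (LFD (A_alg h)) (Suc (Suc 0)) = {\<zero>\<^bsub>?E\<^esub>}" by blast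
  then show ?thesis unfolding lie_solvable_def by blast
qed

lemma LFD_weakly_locally_finite: "weakly_locally_finite_set (A_alg h) (LFD (A_alg h))"
  unfolding weakly_locally_finite_set_def
proof (intro allI impI)
  fix F assume "finite F" "F \<subseteq> LFD (A_alg h)"
  then obtain F' where F': "finite F'" "F' \<subseteq> triangular_derivations h" "F = lift_end ` F'"
    unfolding LFD_eq using finite_subset_image by metis
  show "locally_finite_set (A_alg h) F"
    unfolding F'(3) locally_finite_set_lift_end
    using finite_triangular_invariant_space[OF F'(1,2)] by blast
qed

lemma LFD_not_locally_finite: "\<not> locally_finite_set (A_alg h) (LFD (A_alg h))"
proof
  assume "locally_finite_set (A_alg h) (LFD (A_alg h))"
  then have "\<forall>p. \<exists>U B. ore.subspace U \<and> finite B \<and> U \<subseteq> ore.span B \<and> p \<in> U \<and>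
      (\<forall>D\<in>triangular_derivations h. D ` U \<subseteq> U)"
    unfolding LFD_eq locally_finite_set_lift_end .
  from spec[OF this, of t_elt] obtain U B where U: "finite B" "U \<subseteq> ore.span B" "t_elt \<in> U"
      "\<forall>D\<in>triangular_derivations h. D ` U \<subseteq> U"
    by (elim exE conjE)
  obtain N where N: "ore.span B \<subseteq> degree_box N" using finite_span_degree_box[OF U(1)] by blast
  have "h \<noteq> 0" using h by auto
  then obtain D where "D \<in> triangular_derivations h" "D t_elt \<notin> degree_box N"
    using triangular_no_common_box by blast
  then show False using U N by blast
qed

end

theorem corollary18:
  fixes h :: "'k::{alg_closed_field, field_char_0} poly"
  assumes "degree h > 0"
    and "coprime h (pderiv h)"
  shows "lie_subalgebra (End_alg (A_alg h)) (Der (A_alg h)) (LFD (A_alg h)) \<and>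
    lie_solvable (End_alg (A_alg h)) (LFD (A_alg h)) \<and>
    weakly_locally_finite_set (A_alg h) (LFD (A_alg h)) \<and>
    \<not> locally_finite_set (A_alg h) (LFD (A_alg h))"
  using LFD_lie_subalgebra[OF assms] LFD_solvable[OF assms] LFD_weakly_locally_finite[OF assms]
    LFD_not_locally_finite[OF assms] by blast

end
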